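(* Let $A$ be a $d\times d$ matrix with integer coefficients and $\det(A)\neq0$. Suppose there exists a set $\mathcal E\subseteq\mathbb Z^d\setminus\{0\}$ such that the subspace \[ \mathcal V_{\mathcal E}:=\{f\in L^2_0(\mathbb T^d,dx):\operatorname{supp}(\widehat f)\subseteq\mathcal E\} \] of $L^2_0(\mathbb T^d,dx)$ is a generating wandering subspace for the operator $T_Af=f\circ A$ on $L^2_0(\mathbb T^d,dx)$. Let $\mathbb Y=\mathbb N\cup\{0\}$ if $T_A$ is a unilateral shift and $\mathbb Y=\mathbb Z$ if $T_A$ is a bilateral shift. Suppose that there exist $c>0$, $q>1$ such that, for all $\xi\in\mathcal E$ and $k\in\mathbb Y$, \[ |(A^* )^k\xi|\ge c\,q^{|k|}, \] where $A^*$ is the transpose of $A$. Assume that $f\in L^2(\mathbb T^d,dx)$ has the trigonometric expansion \[ f(x)=\sum_{\xi\in\mathbb Z^d}\widehat f(\xi)e^{2\pi ix\xi} \] and that, for some $\delta>0$, \[ \sum_{\xi\in\mathbb Z^d}(\log(1+|\xi|))^{1+\delta}|\widehat f(\xi)|^2<+\infty . \] Then, for every $\eta>0$ and for almost every $x\in\mathbb T^d$, \[ \lim_{N\to+\infty}\frac{\sqrt N}{(\log(1+N))^{\frac32+\eta}}\bigg|\frac1N\sum_{n=0}^{N-1}f(A^nx)-\int_{\mathbb T^d}f(y)\,dy\bigg|=0 . \]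
   Context: $\mathbb T^d=\mathbb R^d/\mathbb Z^d$ with normalized Lebesgue measure $dx$, on which an integer matrix acts by $x\mapsto Ax$ modulo $\mathbb Z^d$; $L^2_0(\mathbb T^d,dx)$ is the subspace of $L^2(\mathbb T^d,dx)$ of functions with vanishing mean. $x\xi$ is the scalar product, $|\xi|$ the Euclidean norm, $\widehat f(\xi)=\int_{\mathbb T^d}f(x)e^{-2\pi ix\xi}\,dx$, and $\operatorname{supp}(\widehat f)=\{\xi:\widehat f(\xi)\ne0\}$. An isometry $T$ of a Hilbert space $\mathcal H$ is a unilateral shift with generating wandering subspace $\mathcal V$ if $T^m(\mathcal V)\perp T^n(\mathcal V)$ for all $m\ne n$ in $\mathbb N\cup\{0\}$ and $\mathcal H=\bigoplus_{k\in\mathbb N\cup\{0\}}T^k(\mathcal V)$. A unitary operator $T$ is a bilateral shift with generating wandering subspace $\mathcal V$ if $T^m(\mathcal V)\perp T^n(\mathcal V)$ for all $m\ne n$ in $\mathbb Z$ and $\mathcal H=\bigoplus_{k\in\mathbb Z}T^k(\mathcal V)$. "Generating wandering subspace for $T_A$" is meant in one of these two senses. *)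

theory Defs
  imports "HOL-Analysis.Analysis"
begin

section \<open>Integer vectors and matrices\<close>

definition real_vec :: "int ^ 'd \<Rightarrow> real ^ 'd" where
  "real_vec \<xi> = (\<chi> i. real_of_int (\<xi> $ i))"

definition real_mat :: "int ^ 'd ^ 'd \<Rightarrow> real ^ 'd ^ 'd" where
  "real_mat A = (\<chi> i j. real_of_int (A $ i $ j))"

text \<open>\<open>M\<^sup>k v\<close> for an integer exponent \<open>k\<close>; meaningful for negative \<open>k\<close> only if \<open>M\<close> is invertible.\<close>

definition mat_powi_vec :: "real ^ 'd ^ 'd \<Rightarrow> int \<Rightarrow> real ^ 'd \<Rightarrow> real ^ 'd" where
  "mat_powi_vec M k v =
     (if 0 \<le> k then (((*v) M) ^^ nat k) v else (((*v) (matrix_inv M)) ^^ nat (- k)) v)"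


section \<open>Square-integrable functions on the torus\<close>

text \<open>
  A function on \<open>\<real>\<^sup>d/\<int>\<^sup>d\<close> is a \<open>\<int>\<^sup>d\<close>-periodic function on \<open>\<real>\<^sup>d\<close>. For an integer matrix \<open>A\<close> and such
  an \<open>f\<close>, the value \<open>f (A x)\<close> depends on \<open>A x\<close> modulo \<open>\<int>\<^sup>d\<close> only, so no reduction has to be written.
  Integrals and almost-everywhere statements refer to Lebesgue measure on the half-open unit cube,
  a fundamental domain for \<open>\<int>\<^sup>d\<close>.

  The elements of \<open>L2\<close> are functions, not classes of functions. Equality of vectors in the Hilbert
  space is therefore equality almost everywhere on the cube.
\<close>

definition torus :: "(real ^ 'd::finite) measure" where
  "torus = restrict_space lebesgue {x. \<forall>i. 0 \<le> x $ i \<and> x $ i < 1}"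

definition periodic :: "(real ^ 'd \<Rightarrow> 'b) \<Rightarrow> bool" where
  "periodic f \<longleftrightarrow> (\<forall>x \<xi>. f (x + real_vec \<xi>) = f x)"

definition L2 :: "(real ^ 'd::finite \<Rightarrow> complex) set" where
  "L2 = {f. periodic f \<and> f \<in> borel_measurable torus \<and> integrable torus (\<lambda>x. (norm (f x))\<^sup>2)}"

definition L2_zero_mean :: "(real ^ 'd::finite \<Rightarrow> complex) set" where
  "L2_zero_mean = {f \<in> L2. (LINT x|torus. f x) = 0}"

definition L2_inner :: "(real ^ 'd::finite \<Rightarrow> complex) \<Rightarrow> (real ^ 'd \<Rightarrow> complex) \<Rightarrow> complex" where
  "L2_inner f g = (LINT x|torus. f x * cnj (g x))"

definition L2_norm :: "(real ^ 'd::finite \<Rightarrow> complex) \<Rightarrow> real" where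
  "L2_norm f = sqrt (LINT x|torus. (norm (f x))\<^sup>2)"

definition L2_has_sum ::
  "('i \<Rightarrow> real ^ 'd::finite \<Rightarrow> complex) \<Rightarrow> (real ^ 'd \<Rightarrow> complex) \<Rightarrow> 'i set \<Rightarrow> bool" where
  "L2_has_sum w f I \<longleftrightarrow>
     ((\<lambda>F. L2_norm (\<lambda>x. f x - (\<Sum>i\<in>F. w i x))) \<longlongrightarrow> 0) (finite_subsets_at_top I)"

definition character :: "int ^ 'd \<Rightarrow> real ^ 'd::finite \<Rightarrow> complex" where
  "character \<xi> x = exp (2 * of_real pi * \<i> * of_real (x \<bullet> real_vec \<xi>))"

definition fourier_coeff :: "(real ^ 'd::finite \<Rightarrow> complex) \<Rightarrow> int ^ 'd \<Rightarrow> complex" where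
  "fourier_coeff f \<xi> = (LINT x|torus. f x * exp (- 2 * of_real pi * \<i> * of_real (x \<bullet> real_vec \<xi>)))"

definition spectral_subspace :: "(int ^ 'd::finite) set \<Rightarrow> (real ^ 'd \<Rightarrow> complex) set" where
  "spectral_subspace E = {f \<in> L2_zero_mean. {\<xi>. fourier_coeff f \<xi> \<noteq> 0} \<subseteq> E}"

definition koopman :: "int ^ 'd ^ 'd \<Rightarrow> (real ^ 'd \<Rightarrow> complex) \<Rightarrow> real ^ 'd \<Rightarrow> complex" where
  "koopman A f = (\<lambda>x. f (real_mat A *v x))"


section \<open>Shifts on the space of functions with vanishing mean\<close>

definition isometry_op :: "((real ^ 'd::finite \<Rightarrow> complex) \<Rightarrow> real ^ 'd \<Rightarrow> complex) \<Rightarrow> bool" where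
  "isometry_op T \<longleftrightarrow>
     (\<forall>f\<in>L2_zero_mean. T f \<in> L2_zero_mean \<and> L2_norm (T f) = L2_norm f) \<and>
     (\<forall>f\<in>L2_zero_mean. \<forall>g\<in>L2_zero_mean. \<forall>a b.
        AE x in torus. T (\<lambda>y. a * f y + b * g y) x = a * T f x + b * T g x)"

definition unitary_op :: "((real ^ 'd::finite \<Rightarrow> complex) \<Rightarrow> real ^ 'd \<Rightarrow> complex) \<Rightarrow> bool" where
  "unitary_op T \<longleftrightarrow> isometry_op T \<and>
     (\<forall>g\<in>L2_zero_mean. \<exists>f\<in>L2_zero_mean. AE x in torus. T f x = g x)"

text \<open>
  \<open>T\<^sup>k(V)\<close> for an integer \<open>k\<close>. For \<open>k < 0\<close> it is the preimage of \<open>V\<close> under \<open>T\<^sup>-\<^sup>k\<close>, which for unitary \<open>T\<close>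
  is the image of \<open>V\<close> under the corresponding power of the inverse; for other \<open>T\<close> it is not used.
\<close>

definition op_image ::
  "((real ^ 'd::finite \<Rightarrow> complex) \<Rightarrow> real ^ 'd \<Rightarrow> complex) \<Rightarrow> int \<Rightarrow>
   (real ^ 'd \<Rightarrow> complex) set \<Rightarrow> (real ^ 'd \<Rightarrow> complex) set" where
  "op_image T k V =
     (if 0 \<le> k then (T ^^ nat k) ` V
      else {g \<in> L2_zero_mean. \<exists>v\<in>V. AE x in torus. (T ^^ nat (- k)) g x = v x})"

text \<open>
  The last clause expresses that the space is the Hilbert direct sum of the pairwise orthogonal
  subspaces \<open>T\<^sup>k(V)\<close>, \<open>k \<in> K\<close>.
\<close>

definition generating_wandering ::
  "int set \<Rightarrow> ((real ^ 'd::finite \<Rightarrow> complex) \<Rightarrow> real ^ 'd \<Rightarrow> complex) \<Rightarrow>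
   (real ^ 'd \<Rightarrow> complex) set \<Rightarrow> bool" where
  "generating_wandering K T V \<longleftrightarrow>
     V \<subseteq> L2_zero_mean \<and>
     (\<forall>m\<in>K. \<forall>n\<in>K. m \<noteq> n \<longrightarrow>
        (\<forall>f\<in>op_image T m V. \<forall>g\<in>op_image T n V. L2_inner f g = 0)) \<and>
     (\<forall>f\<in>L2_zero_mean. \<exists>w. (\<forall>k\<in>K. w k \<in> op_image T k V) \<and> L2_has_sum w f K)"

definition unilateral_shift ::
  "((real ^ 'd::finite \<Rightarrow> complex) \<Rightarrow> real ^ 'd \<Rightarrow> complex) \<Rightarrow> (real ^ 'd \<Rightarrow> complex) set \<Rightarrow> bool" where
  "unilateral_shift T V \<longleftrightarrow> isometry_op T \<and> generating_wandering {0..} T V"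

definition bilateral_shift ::
  "((real ^ 'd::finite \<Rightarrow> complex) \<Rightarrow> real ^ 'd \<Rightarrow> complex) \<Rightarrow> (real ^ 'd \<Rightarrow> complex) set \<Rightarrow> bool" where
  "bilateral_shift T V \<longleftrightarrow> unitary_op T \<and> generating_wandering UNIV T V"

end

theory Submission
  imports Defs
begin

text \<open>
  Put \<open>g = f - \<integral>f\<close>. Since \<open>e\<^sub>\<zeta> \<circ> A = e\<^sub>B\<^sub>\<zeta>\<close> with \<open>B\<close> the transpose of \<open>A\<close>, the wandering subspace
  assigns to each nonzero frequency \<open>\<zeta>\<close> a unique level \<open>\<kappa>(\<zeta>) \<in> Y\<close> with \<open>\<kappa>(B \<zeta>) = \<kappa>(\<zeta>) + 1\<close> and
  \<open>|\<zeta>| \<ge> c q\<^bsup>|\<kappa>(\<zeta>)|\<^esup>\<close>, so the hypothesis on \<open>f\<close> bounds the sum of \<open>(1 + |\<kappa>(\<zeta>)|)\<^bsup>1 + \<delta>\<^esup> |f^(\<zeta>)|\<^sup>2\<close>. Two terms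
  of \<open>\<Sum>n\<in>I. g \<circ> A\<^sup>n\<close> interact only along an orbit of \<open>B\<close>, where the levels of the terms meeting in one
  frequency are distinct; Schur's test with the summable weights \<open>(1 + |k|)\<^bsup>-(1 + \<delta>)\<^esup>\<close> then bounds the
  squared norm of the sum by a constant times \<open>card I\<close>. The almost everywhere rate follows from this
  by the Rademacher--Menshov dyadic decomposition.
\<close>

section \<open>Translations and characters of the torus\<close>

definition unit_cube :: "(real ^ 'd) set" where
  "unit_cube = {x. \<forall>i. 0 \<le> x $ i \<and> x $ i < 1}"

definition vec_floor :: "real ^ 'd \<Rightarrow> int ^ 'd" where
  "vec_floor x = (\<chi> i. \<lfloor>x $ i\<rfloor>)"

lemma torus_eq: "torus = restrict_space lebesgue unit_cube"
  by (simp add: torus_def unit_cube_def)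

lemma unit_cube_borel: "(unit_cube :: (real ^ 'd::finite) set) \<in> sets borel"
proof -
 have "{x :: real ^ 'd. 0 \<le> x $ i} \<inter> {x. x $ i < 1} \<in> sets borel" for i
    by (intro sets.Int borel_closed borel_open closed_halfspace_component_ge_cart
        open_halfspace_component_lt_cart)
  then have "(\<Inter>i. {x :: real ^ 'd. 0 \<le> x $ i} \<inter> {x. x $ i < 1}) \<in> sets borel"
    by (intro sets.finite_INT) auto
  also have "(\<Inter>i. {x :: real ^ 'd. 0 \<le> x $ i} \<inter> {x. x $ i < 1}) = unit_cube"
    by (auto simp: unit_cube_def)
  finally show ?thesis .
qed

lemma unit_cube_lebesgue: "(unit_cube :: (real ^ 'd::finite) set) \<in> sets lebesgue"
  using unit_cube_borel by (auto intro: sets_completionI_sets)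

lemma space_torus: "space torus = unit_cube"
  by (simp add: torus_eq space_restrict_space)

lemma sets_torus: "sets torus = {X \<in> sets lebesgue. X \<subseteq> unit_cube}"
  by (auto simp: torus_eq sets_restrict_space_iff unit_cube_lebesgue)

lemma emeasure_torus: "X \<in> sets torus \<Longrightarrow> emeasure torus X = emeasure lebesgue X"
  by (auto simp: torus_eq sets_restrict_space_iff emeasure_restrict_space unit_cube_lebesgue)

text \<open>The half-open cube lies between the open and the closed unit box, both of volume
  1.\<close>

lemma emeasure_unit_cube: "emeasure lebesgue (unit_cube :: (real ^ 'd::finite) set) = 1"
proof (rule antisym)
  let ?Q = "unit_cube :: (real ^ 'd) set"
  have One: "(One :: real ^ 'd) $ i = 1" for i
    by (simp add: cart_eq_inner_axis inner_sum_left inner_Basis axis_in_Basis_iff)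
  have "?Q \<subseteq> cbox 0 One"
    by (force simp: unit_cube_def mem_box_cart One less_imp_le simp del: sum_component)
  then have "emeasure lebesgue ?Q \<le> emeasure lebesgue (cbox 0 (One :: real ^ 'd))"
    by (intro emeasure_mono) auto
  then show "emeasure lebesgue ?Q \<le> 1"
    by (simp add: emeasure_lborel_cbox_eq)
  have "box 0 One \<subseteq> ?Q"
    by (force simp: unit_cube_def mem_box_cart One less_imp_le simp del: sum_component)
  then have "emeasure lebesgue (box 0 (One :: real ^ 'd)) \<le> emeasure lebesgue ?Q"
    by (intro emeasure_mono unit_cube_lebesgue)
  then show "emeasure lebesgue ?Q \<ge> 1"
    by (simp add: emeasure_lborel_box_eq)
qed

lemma real_vec_add: "real_vec (x + y) = real_vec x + real_vec y"
  and real_vec_minus: "real_vec (- x) = - real_vec x"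
  and real_vec_0: "real_vec 0 = 0"
  by (simp_all add: real_vec_def vec_eq_iff)

lemma real_vec_inject: "real_vec x = real_vec y \<longleftrightarrow> x = y"
  by (simp add: real_vec_def vec_eq_iff)

lemma diff_vec_floor_in_cube: "x - real_vec (vec_floor x) \<in> unit_cube"
  by (simp add: unit_cube_def real_vec_def vec_floor_def) linarith

lemma vec_floor_unique: "x - real_vec \<xi> \<in> unit_cube \<longleftrightarrow> \<xi> = vec_floor x"
proof
  assume "x - real_vec \<xi> \<in> unit_cube"
  then have "\<xi> $ i = \<lfloor>x $ i\<rfloor>" for i
    by (auto simp: unit_cube_def real_vec_def dest!: spec[of _ i] intro!: floor_unique[symmetric])
  then show "\<xi> = vec_floor x"
    by (simp add: vec_eq_iff vec_floor_def)
qed (simp add: diff_vec_floor_in_cube)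

text \<open>Translation on the quotient, read on the fundamental domain: the measure lives on the
  cube, so the translate has to be moved back by an integer vector to give a self-map.\<close>

definition torus_shift :: "real ^ 'd \<Rightarrow> real ^ 'd \<Rightarrow> real ^ 'd" where
  "torus_shift t x = x + t - real_vec (vec_floor (x + t))"

lemma translate_lebesgue:
  fixes X :: "(real ^ 'd::finite) set"
  assumes "X \<in> sets lebesgue"
  shows "(+) a ` X \<in> sets lebesgue" and "emeasure lebesgue ((+) a ` X) = emeasure lebesgue X"
  using lebesgue_sets_translation[OF assms, of a] emeasure_lebesgue_affine[of 1 a X]
  by (simp_all add: add.commute[of a])

text \<open>Cut along the integer vector \<xi> that has to be subtracted: \<open>P \<xi>\<close> is
  the part of the preimage and \<open>R \<xi>\<close> the part of \<open>X\<close> belonging to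
  \<xi>. One ordinary translation carries \<open>P \<xi>\<close> onto \<open>R \<xi>\<close>, and
  both families are disjoint and countable.\<close>

lemma torus_shift_preserves:
  fixes X :: "(real ^ 'd::finite) set"
  assumes X: "X \<in> sets torus"
  shows "torus_shift t -` X \<inter> unit_cube \<in> sets torus"
    and "emeasure torus (torus_shift t -` X \<inter> unit_cube) = emeasure torus X"
proof -
  define P where "P \<xi> = ((+) (real_vec \<xi> - t) ` X) \<inter> unit_cube" for \<xi>
  define R where "R \<xi> = X \<inter> (+) (t - real_vec \<xi>) ` unit_cube" for \<xi>
  have Xl: "X \<in> sets lebesgue" and XQ: "X \<subseteq> unit_cube"
    using X by (auto simp: sets_torus)
  have memP: "x \<in> P \<xi> \<longleftrightarrow> x \<in> unit_cube \<and> x + t - real_vec \<xi> \<in> X" for x \<xi>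
    by (auto simp: P_def image_iff algebra_simps intro!: bexI[of _ "x + t - real_vec \<xi>"])
  have memR: "y \<in> R \<xi> \<longleftrightarrow> y \<in> X \<and> y - t + real_vec \<xi> \<in> unit_cube" for y \<xi>
    by (auto simp: R_def image_iff algebra_simps intro!: bexI[of _ "y - t + real_vec \<xi>"])
  have Pl: "P \<xi> \<in> sets lebesgue" and Rl: "R \<xi> \<in> sets lebesgue" for \<xi>
    unfolding P_def R_def by (intro sets.Int translate_lebesgue Xl unit_cube_lebesgue)+
  have PU: "torus_shift t -` X \<inter> unit_cube = (\<Union>\<xi>. P \<xi>)"
  proof -
    have "torus_shift t x \<in> X \<longleftrightarrow> (\<exists>\<xi>. x + t - real_vec \<xi> \<in> X)" for x
      using XQ vec_floor_unique by (fastforce simp: torus_shift_def)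
    then show ?thesis by (auto simp: memP)
  qed
  have RU: "X = (\<Union>\<xi>. R \<xi>)"
  proof -
    have "\<exists>\<xi>. y - t + real_vec \<xi> \<in> unit_cube" for y
      using diff_vec_floor_in_cube[of "y - t"]
      by (intro exI[of _ "- vec_floor (y - t)"]) (simp add: real_vec_minus)
    then show ?thesis by (auto simp: memR)
  qed
  have dP: "disjoint_family_on P UNIV"
  proof -
    have "\<xi> = vec_floor (x + t)" if "x \<in> P \<xi>" for x \<xi>
      using that XQ vec_floor_unique[of "x + t" \<xi>] by (auto simp: memP)
    then have "P \<xi> \<inter> P \<zeta> = {}" if "\<xi> \<noteq> \<zeta>" for \<xi> \<zeta>
      using that by blast
    then show ?thesis by (simp add: disjoint_family_on_def)
  qed
  have dR: "disjoint_family_on R UNIV"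
  proof -
    have "\<xi> = - vec_floor (y - t)" if "y \<in> R \<xi>" for y \<xi>
      using vec_floor_unique[of "y - t" "- \<xi>"] that
      by (simp add: memR real_vec_minus) (metis minus_minus)
    then have "R \<xi> \<inter> R \<zeta> = {}" if "\<xi> \<noteq> \<zeta>" for \<xi> \<zeta>
      using that by blast
    then show ?thesis by (simp add: disjoint_family_on_def)
  qed
  have eq: "emeasure lebesgue (P \<xi>) = emeasure lebesgue (R \<xi>)" for \<xi>
  proof -
    have "R \<xi> = (+) (t - real_vec \<xi>) ` P \<xi>"
      by (auto simp: memP memR image_iff algebra_simps intro!: bexI[of _ "_ - t + real_vec \<xi>"])
    then show ?thesis using translate_lebesgue(2)[OF Pl] by simp
  qed
  show st: "torus_shift t -` X \<inter> unit_cube \<in> sets torus"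
    unfolding sets_torus PU using Pl by (auto simp: memP)
  have "emeasure lebesgue (\<Union>\<xi>. P \<xi>) = emeasure lebesgue (\<Union>\<xi>. R \<xi>)"
    using Pl Rl dP dR eq by (simp add: emeasure_UN_countable)
  then show "emeasure torus (torus_shift t -` X \<inter> unit_cube) = emeasure torus X"
    using X st PU RU by (simp add: emeasure_torus)
qed

lemma measurable_torus_shift: "torus_shift t \<in> torus \<rightarrow>\<^sub>M (torus :: (real ^ 'd::finite) measure)"
  by (rule measurableI)
     (auto simp: space_torus torus_shift_def diff_vec_floor_in_cube torus_shift_preserves)

lemma distr_torus_shift: "distr torus torus (torus_shift t) = (torus :: (real ^ 'd::finite) measure)"
  by (rule measure_eqI)
     (auto simp: emeasure_distr measurable_torus_shift space_torus torus_shift_preserves)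

lemma periodic_torus_shift: "periodic h \<Longrightarrow> h (torus_shift t x) = h (x + t)"
  unfolding periodic_def torus_shift_def
  by (metis diff_add_cancel)

lemma integral_torus_translate:
  fixes h :: "real ^ 'd::finite \<Rightarrow> complex"
  assumes "periodic h" "h \<in> borel_measurable torus"
  shows "(LINT x|torus. h (x + t)) = (LINT x|torus. h x)"
  using integral_distr[OF measurable_torus_shift[of t] assms(2)]
  by (simp add: distr_torus_shift periodic_torus_shift[OF assms(1)])

text \<open>Invariance of the integral I gives I = c I. This yields both the orthogonality of
  characters and the constraint on the spectrum of functions composed with \<open>A\<close>.\<close>

lemma integral_torus_eq_0:
  fixes h :: "real ^ 'd::finite \<Rightarrow> complex"
  assumes "periodic h" "h \<in> borel_measurable torus" "\<And>x. h (x + t) = c * h x" "c \<noteq> 1"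
  shows "(LINT x|torus. h x) = 0"
  using integral_torus_translate[OF assms(1,2), of t] assms(3,4) by simp

section \<open>Square-integrable functions on the torus\<close>

lemma measure_torus [simp]: "measure torus (space torus) = 1"
proof -
  have "emeasure torus (space torus) = 1"
    by (simp add: emeasure_torus emeasure_unit_cube flip: space_torus)
       (simp add: space_torus emeasure_unit_cube)
  then show ?thesis by (simp add: measure_def)
qed

lemma finite_measure_torus: "finite_measure torus"
  by (rule finite_measureI) (simp add: emeasure_torus space_torus emeasure_unit_cube
      sets_torus unit_cube_lebesgue)

lemma integrable_torus_const [simp]: "integrable torus (\<lambda>x. c :: 'b :: {banach, second_countable_topology})"
  by (rule finite_measure.integrable_const[OF finite_measure_torus])

lemma periodic_add: "periodic f \<Longrightarrow> periodic g \<Longrightarrow> periodic (\<lambda>x. a * f x + b * g x)"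
  by (simp add: periodic_def)

lemma norm_mult_le_squares: "norm (a * b) \<le> (norm a)\<^sup>2 + (norm b)\<^sup>2"
  for a b :: complex
proof -
  have "2 * (norm a * norm b) \<le> (norm a)\<^sup>2 + (norm b)\<^sup>2"
    using sum_squares_bound[of "norm a" "norm b"] by simp
  then show ?thesis
    using mult_nonneg_nonneg[OF norm_ge_zero[of a] norm_ge_zero[of b]]
    unfolding norm_mult by linarith
qed

lemma L2_mult_integrable:
  assumes "f \<in> L2" "g \<in> L2"
  shows "integrable torus (\<lambda>x. f x * g x)"
proof (rule Bochner_Integration.integrable_bound)
  show "integrable torus (\<lambda>x. (norm (f x))\<^sup>2 + (norm (g x))\<^sup>2)"
    using assms by (simp add: L2_def)
  show "(\<lambda>x. f x * g x) \<in> borel_measurable torus"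
    using assms by (auto simp: L2_def)
  show "AE x in torus. norm (f x * g x) \<le> norm ((norm (f x))\<^sup>2 + (norm (g x))\<^sup>2)"
    using norm_mult_le_squares by (intro AE_I2) simp
qed

lemma L2_cnj: "f \<in> L2 \<Longrightarrow> (\<lambda>x. cnj (f x)) \<in> L2"
  by (auto simp: L2_def periodic_def intro!: measurable_compose[OF _ borel_measurable_continuous_onI[of cnj]] continuous_intros)

lemma L2_const: "(\<lambda>x. c) \<in> L2"
  by (simp add: L2_def periodic_def)

lemma L2_integrable: "f \<in> L2 \<Longrightarrow> integrable torus f"
  using L2_mult_integrable[OF _ L2_const[of 1]] by simp

lemma L2_lincomb:
  assumes "f \<in> L2" "g \<in> L2"
  shows "(\<lambda>x. a * f x + b * g x) \<in> L2"
proof -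
  have "integrable torus (\<lambda>x. (norm (a * f x + b * g x))\<^sup>2)"
  proof (rule Bochner_Integration.integrable_bound)
    show "integrable torus (\<lambda>x. 2 * ((norm a)\<^sup>2 * (norm (f x))\<^sup>2) + 2 * ((norm b)\<^sup>2 * (norm (g x))\<^sup>2))"
      using assms by (simp add: L2_def)
    show "(\<lambda>x. (norm (a * f x + b * g x))\<^sup>2) \<in> borel_measurable torus"
      using assms by (auto simp: L2_def)
    have "(norm (u + v))\<^sup>2 \<le> 2 * (norm u)\<^sup>2 + 2 * (norm v)\<^sup>2" for u v :: complex
      by (smt (verit) norm_triangle_ineq norm_ge_zero power_mono sum_squares_bound power2_sum)
    then show "AE x in torus. norm ((norm (a * f x + b * g x))\<^sup>2) \<le>
        norm (2 * ((norm a)\<^sup>2 * (norm (f x))\<^sup>2) + 2 * ((norm b)\<^sup>2 * (norm (g x))\<^sup>2))"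
      by (intro AE_I2) (simp add: norm_mult[symmetric] power_mult_distrib[symmetric])
  qed
  then show ?thesis
    using assms by (auto simp: L2_def periodic_add)
qed

lemma L2_zero_mean_lincomb:
  assumes "f \<in> L2_zero_mean" "g \<in> L2_zero_mean"
  shows "(\<lambda>x. a * f x + b * g x) \<in> L2_zero_mean"
  using assms L2_lincomb[of f g a b] L2_integrable[of f] L2_integrable[of g]
  by (auto simp: L2_zero_mean_def)

lemma L2_sum: "(\<And>i. i \<in> I \<Longrightarrow> w i \<in> L2) \<Longrightarrow> (\<lambda>x. \<Sum>i\<in>I. w i x) \<in> L2"
proof (induction I rule: infinite_finite_induct)
  case (insert i I)
  then show ?case
    using L2_lincomb[of "w i" "\<lambda>x. \<Sum>i\<in>I. w i x" 1 1] by simp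
qed (simp_all add: L2_const)

lemma L2_zero_mean_sum:
  "(\<And>i. i \<in> I \<Longrightarrow> w i \<in> L2_zero_mean) \<Longrightarrow> (\<lambda>x. \<Sum>i\<in>I. w i x) \<in> L2_zero_mean"
proof (induction I rule: infinite_finite_induct)
  case (insert i I)
  then show ?case
    using L2_zero_mean_lincomb[of "w i" "\<lambda>x. \<Sum>i\<in>I. w i x" 1 1] by simp
qed (simp_all add: L2_zero_mean_def L2_const)

lemma L2_norm_square: "(L2_norm f)\<^sup>2 = (LINT x|torus. (norm (f x))\<^sup>2)"
  by (simp add: L2_norm_def)

lemma L2_norm_nonneg: "L2_norm f \<ge> 0"
  by (simp add: L2_norm_def)

section \<open>Characters and Fourier coefficients\<close>

lemma character_add: "character \<xi> (x + y) = character \<xi> x * character \<xi> y"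
  by (simp add: character_def inner_add_left exp_add[symmetric] algebra_simps)

lemma character_0: "character 0 x = 1"
  by (simp add: character_def real_vec_0)

lemma character_plus: "character (\<xi> + \<zeta>) x = character \<xi> x * character \<zeta> x"
  by (simp add: character_def real_vec_add inner_add_right exp_add[symmetric] algebra_simps)

lemma cnj_character: "cnj (character \<xi> x) = character (- \<xi>) x"
  by (simp add: character_def exp_cnj real_vec_minus)

lemma norm_character [simp]: "norm (character \<xi> x) = 1"
proof -
  have "character \<xi> x = exp (\<i> * of_real (2 * pi * (x \<bullet> real_vec \<xi>)))"
    by (simp add: character_def algebra_simps)
  then show ?thesis by (simp only: norm_exp_i_times)
qed

lemma character_eq_1_iff: "character \<xi> x = 1 \<longleftrightarrow> x \<bullet> real_vec \<xi> \<in> \<int>"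
  by (auto simp: character_def exp_eq_1 Ints_def)

lemma character_real_vec: "character \<xi> (real_vec \<zeta>) = 1"
  unfolding character_eq_1_iff by (auto simp: real_vec_def inner_vec_def intro!: Ints_sum Ints_mult)

lemma periodic_character: "periodic (character \<xi>)"
  by (simp add: periodic_def character_add character_real_vec)

lemma torus_measurable_borel:
  "g \<in> borel_measurable borel \<Longrightarrow> (g :: real ^ 'd::finite \<Rightarrow> complex) \<in> borel_measurable torus"
  unfolding torus_eq
  by (rule measurable_restrict_space1) (simp add: borel_measurable_if_lebesgue_on measurable_completion)

lemma character_measurable [measurable]: "character \<xi> \<in> borel_measurable torus"
  by (rule torus_measurable_borel, rule borel_measurable_continuous_onI)
     (simp add: character_def[abs_def] continuous_intros)

lemma character_L2: "character \<xi> \<in> L2"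
  by (simp add: L2_def periodic_character)

lemma integral_character:
  fixes \<xi> :: "int ^ 'd::finite"
  shows "(LINT x|torus. character \<xi> x) = (if \<xi> = 0 then 1 else 0)"
proof (cases "\<xi> = 0")
  case False
  then obtain i where i: "\<xi> $ i \<noteq> 0" by (auto simp: vec_eq_iff)
  \<comment> \<open>Chosen to have scalar product 1/2 with \<xi>, so that translation by
    \<open>t\<close> multiplies the character by a factor other than 1.\<close>
  define t where "t = axis i (1 / (2 * real_of_int (\<xi> $ i)))"
  have t: "t \<bullet> real_vec \<xi> = 1 / 2"
    using i by (simp add: t_def inner_axis' real_vec_def)
  have "(1 / 2 :: real) \<notin> \<int>"
  proof
    assume "(1 / 2 :: real) \<in> \<int>"
    then obtain k where "1 / 2 = real_of_int k" by (auto elim: Ints_cases)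
    then have "real_of_int (2 * k) = real_of_int 1" by simp
    then have "2 * k = 1" by (simp only: of_int_eq_iff)
    then show False by presburger
  qed
  then have "character \<xi> t \<noteq> 1"
    unfolding character_eq_1_iff t .
  then show ?thesis
    using integral_torus_eq_0[of "character \<xi>" t "character \<xi> t"] False
    by (simp add: periodic_character character_add mult.commute)
qed (simp add: character_0)

lemma character_zero_mean: "\<xi> \<noteq> 0 \<Longrightarrow> character \<xi> \<in> L2_zero_mean"
  by (simp add: L2_zero_mean_def character_L2 integral_character)

lemma inner_character: "L2_inner (character \<xi>) (character \<zeta>) = (if \<xi> = \<zeta> then 1 else 0)"
  by (simp add: L2_inner_def cnj_character integral_character flip: character_plus)

lemma fourier_coeff_eq_inner: "fourier_coeff f \<xi> = L2_inner f (character \<xi>)"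
  by (simp add: fourier_coeff_def L2_inner_def character_def exp_cnj)

lemma L2_inner_sum_left:
  assumes "\<And>i. i \<in> I \<Longrightarrow> w i \<in> L2" "h \<in> L2"
  shows "L2_inner (\<lambda>x. \<Sum>i\<in>I. w i x) h = (\<Sum>i\<in>I. L2_inner (w i) h)"
  using assms by (simp add: L2_inner_def sum_distrib_right L2_mult_integrable L2_cnj)

text \<open>The free scalar \<open>b\<close> serves polarization (\<open>b\<close> equal to 1 and
  \<open>\<i>\<close>) as well as the parallelogram law (\<open>b\<close> equal to 1 and
  -1).\<close>

lemma L2_norm_square_lincomb:
  assumes "f \<in> L2" "g \<in> L2"
  shows "(L2_norm (\<lambda>x. f x + b * g x))\<^sup>2 =
    (L2_norm f)\<^sup>2 + (norm b)\<^sup>2 * (L2_norm g)\<^sup>2 + 2 * Re (cnj b * L2_inner f g)"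
proof -
  have fg: "integrable torus (\<lambda>x. f x * cnj (g x))"
    using assms by (simp add: L2_mult_integrable L2_cnj)
  have "(norm (u + b * v))\<^sup>2 = (norm u)\<^sup>2 + (norm b)\<^sup>2 * (norm v)\<^sup>2 + 2 * Re (cnj b * (u * cnj v))" for u v
    unfolding cmod_power2 by (simp add: power2_eq_square algebra_simps)
  then have "(L2_norm (\<lambda>x. f x + b * g x))\<^sup>2 = (LINT x|torus.
      (norm (f x))\<^sup>2 + (norm b)\<^sup>2 * (norm (g x))\<^sup>2 + 2 * Re (cnj b * (f x * cnj (g x))))"
    by (simp add: L2_norm_square)
  also have "\<dots> = (L2_norm f)\<^sup>2 + (norm b)\<^sup>2 * (L2_norm g)\<^sup>2 +
      2 * (LINT x|torus. Re (cnj b * (f x * cnj (g x))))"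
    using assms fg by (simp add: L2_norm_square L2_def del: times_complex.sel)
  also have "(LINT x|torus. Re (cnj b * (f x * cnj (g x)))) = Re (cnj b * L2_inner f g)"
    using fg by (simp add: L2_inner_def integral_Re del: times_complex.sel)
  finally show ?thesis .
qed

section \<open>The action on characters\<close>

text \<open>The map B of the overview, kept over the integers: for nonzero determinant it is
  injective on the lattice but need not be onto.\<close>

definition dual :: "int ^ 'd ^ 'd \<Rightarrow> int ^ 'd \<Rightarrow> int ^ 'd" where
  "dual A \<xi> = transpose A *v \<xi>"

lemma real_vec_dual: "real_vec (dual A \<xi>) = transpose (real_mat A) *v real_vec \<xi>"
  by (simp add: dual_def real_vec_def real_mat_def transpose_def vec_eq_iff
      matrix_vector_mult_def del: transpose_matrix_vector)

lemma dual_0 [simp]: "dual A 0 = 0"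
  by (simp add: dual_def del: transpose_matrix_vector)

lemma det_real_mat: "det (real_mat A) = real_of_int (det A)"
  by (simp add: det_def real_mat_def)

lemma matrix_inv_cancel:
  fixes M :: "real ^ 'd ^ 'd"
  assumes "invertible M"
  shows "M ** matrix_inv M = mat 1" and "matrix_inv M ** M = mat 1"
  using someI_ex[OF assms[unfolded invertible_def]] by (simp_all add: matrix_inv_def)

lemma inj_dual:
  assumes "det A \<noteq> 0"
  shows "inj (dual A)"
proof (rule injI)
  fix x y assume "dual A x = dual A y"
  then have "transpose (real_mat A) *v real_vec x = transpose (real_mat A) *v real_vec y"
    by (metis real_vec_dual)
  moreover have "invertible (transpose (real_mat A))"
    using assms by (simp add: invertible_det_nz det_transpose det_real_mat)
  ultimately have "real_vec x = real_vec y"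
    by (metis inj_matrix_vector_mult injD)
  then show "x = y" by (simp add: real_vec_inject)
qed

lemma inj_dual_pow: "det A \<noteq> 0 \<Longrightarrow> inj (dual A ^^ n)"
  by (induction n) (auto simp: inj_dual inj_compose)

lemma dual_pow_0 [simp]: "(dual A ^^ n) 0 = 0"
  by (induction n) simp_all

lemma dual_pow_eq_0_iff: "det A \<noteq> 0 \<Longrightarrow> (dual A ^^ n) \<xi> = 0 \<longleftrightarrow> \<xi> = 0"
  using injD[OF inj_dual_pow, of A n \<xi> 0] by auto

lemma koopman_character: "koopman A (character \<xi>) = character (dual A \<xi>)"
proof -
  have "x \<bullet> real_vec (dual A \<xi>) = (real_mat A *v x) \<bullet> real_vec \<xi>" for x
    by (metis real_vec_dual transpose_matrix_vector dot_lmul_matrix inner_commute)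
  then show ?thesis by (simp add: koopman_def character_def fun_eq_iff)
qed

lemma koopman_pow_character: "(koopman A ^^ n) (character \<xi>) = character ((dual A ^^ n) \<xi>)"
  by (induction n) (simp_all add: koopman_character)

lemma koopman_pow: "(koopman A ^^ n) f x = f (((*v) (real_mat A) ^^ n) x)"
proof (induction n arbitrary: x)
  case (Suc n)
  then show ?case
    by (simp add: koopman_def[of A "(koopman A ^^ n) f"] funpow_swap1[of "(*v) (real_mat A)"])
qed simp

text \<open>Polarization: the norm of f + b g is preserved for every scalar b, and b = 1 and b = i
  recover the real and the imaginary part of the inner product.\<close>

lemma koopman_inner:
  assumes T: "isometry_op (koopman A)" and f: "f \<in> L2_zero_mean" and g: "g \<in> L2_zero_mean"
  shows "L2_inner (koopman A f) (koopman A g) = L2_inner f g"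
proof -
  have L2: "f \<in> L2" "g \<in> L2" "koopman A f \<in> L2" "koopman A g \<in> L2"
    and norms: "L2_norm (koopman A f) = L2_norm f" "L2_norm (koopman A g) = L2_norm g"
    using T f g by (auto simp: isometry_op_def L2_zero_mean_def)
  have eq: "Re (cnj b * L2_inner (koopman A f) (koopman A g)) = Re (cnj b * L2_inner f g)" for b
  proof -
    have "(\<lambda>x. f x + b * g x) \<in> L2_zero_mean"
      using L2_zero_mean_lincomb[OF f g, of 1 b] by simp
    then have "L2_norm (koopman A (\<lambda>x. f x + b * g x)) = L2_norm (\<lambda>x. f x + b * g x)"
      using T by (auto simp: isometry_op_def)
    then have "L2_norm (\<lambda>x. koopman A f x + b * koopman A g x) = L2_norm (\<lambda>x. f x + b * g x)"
      by (simp add: koopman_def)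
    then show ?thesis
      using L2_norm_square_lincomb[OF L2(1,2), of b] L2_norm_square_lincomb[OF L2(3,4), of b] norms
      by simp
  qed
  show ?thesis
    using eq[of 1] eq[of \<i>] by (simp add: complex_eq_iff)
qed

lemma koopman_pow_zero_mean:
  "isometry_op (koopman A) \<Longrightarrow> f \<in> L2_zero_mean \<Longrightarrow> (koopman A ^^ n) f \<in> L2_zero_mean"
  by (induction n) (auto simp: isometry_op_def)

lemma koopman_pow_inner:
  "isometry_op (koopman A) \<Longrightarrow> f \<in> L2_zero_mean \<Longrightarrow> g \<in> L2_zero_mean \<Longrightarrow>
    L2_inner ((koopman A ^^ n) f) ((koopman A ^^ n) g) = L2_inner f g"
  by (induction n) (simp_all add: koopman_inner koopman_pow_zero_mean)

lemma koopman_pow_norm: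
  "isometry_op (koopman A) \<Longrightarrow> f \<in> L2_zero_mean \<Longrightarrow> L2_norm ((koopman A ^^ n) f) = L2_norm f"
proof (induction n)
  case (Suc n)
  then show ?case
    using koopman_pow_zero_mean[of A f n] by (simp add: isometry_op_def)
qed simp

text \<open>
  \<open>u \<circ> A\<close> is invariant under translation by the columns of the inverse of \<open>A\<close>, and only the characters
  in the image of the transpose of \<open>A\<close> share this invariance.
\<close>

lemma koopman_inner_character:
  fixes A :: "int ^ 'd::finite ^ 'd"
  assumes A: "det A \<noteq> 0" and T: "isometry_op (koopman A)" and u: "u \<in> L2_zero_mean"
    and ne: "L2_inner (koopman A u) (character \<zeta>) \<noteq> 0"
  obtains \<xi> where "dual A \<xi> = \<zeta>" "\<xi> \<noteq> 0" "L2_inner u (character \<xi>) \<noteq> 0"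
proof -
  have Tu: "koopman A u \<in> L2_zero_mean"
    using T u by (simp add: isometry_op_def)
  have "\<zeta> \<noteq> 0"
    using ne Tu by (auto simp: L2_inner_def character_0 L2_zero_mean_def)
  define M where "M = real_mat A"
  have "invertible M"
    using A by (simp add: invertible_det_nz det_real_mat M_def)
  then have MI: "M ** matrix_inv M = mat 1" "matrix_inv M ** M = mat 1"
    by (rule matrix_inv_cancel)+
  \<comment> \<open>The columns of the inverse of \<open>M\<close>: moving x by \<open>t i\<close>
    moves M x by a unit vector, which the periodic \<open>u\<close> does not see.\<close>
  define t where "t i = matrix_inv M *v axis i 1" for i
  have Mt: "M *v t i = real_vec (axis i 1)" for i
    by (simp add: t_def matrix_vector_mul_assoc MI real_vec_def vec_eq_iff axis_def)
  have "t i \<bullet> real_vec \<zeta> \<in> \<int>" for i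
  proof (rule ccontr)
    assume nint: "t i \<bullet> real_vec \<zeta> \<notin> \<int>"
    \<comment> \<open>Without integrality, \<open>?h\<close> would be an eigenfunction of this
      translation with an eigenvalue other than 1, and the coefficient would vanish.\<close>
    let ?h = "\<lambda>x. koopman A u x * cnj (character \<zeta> x)"
    have "character \<zeta> (t i) \<noteq> 1" using nint by (simp add: character_eq_1_iff)
    then have c: "cnj (character \<zeta> (t i)) \<noteq> 1" by simp
    have "periodic u" using u by (simp add: L2_zero_mean_def L2_def)
    then have shift: "?h (x + t i) = cnj (character \<zeta> (t i)) * ?h x" for x
      by (simp add: koopman_def character_add matrix_vector_right_distrib periodic_def
          Mt[unfolded M_def])
    have "periodic (koopman A u)" "koopman A u \<in> borel_measurable torus"
      using Tu by (auto simp: L2_zero_mean_def L2_def)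
    then have "periodic ?h" "?h \<in> borel_measurable torus"
      using periodic_character[of "- \<zeta>"] by (auto simp: periodic_def cnj_character)
    from integral_torus_eq_0[OF this shift c] ne show False
      by (simp add: L2_inner_def)
  qed
  \<comment> \<open>These integers are the coordinates of the real preimage of \<zeta> under the
    transpose of \<open>M\<close>, so that preimage is a lattice vector.\<close>
  then obtain \<xi> where \<xi>: "t i \<bullet> real_vec \<zeta> = real_of_int (\<xi> $ i)" for i
  proof -
    have "\<forall>i. \<exists>k. t i \<bullet> real_vec \<zeta> = real_of_int k"
      using \<open>\<And>i. t i \<bullet> real_vec \<zeta> \<in> \<int>\<close> by (auto simp: Ints_def)
    then obtain k where "\<And>i. t i \<bullet> real_vec \<zeta> = real_of_int (k i)" by metis
    then show thesis by (intro that[of "\<chi> i. k i"]) simp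
  qed
  have "real_vec \<xi> = transpose (matrix_inv M) *v real_vec \<zeta>"
  proof -
    have "real_vec \<xi> $ i = (transpose (matrix_inv M) *v real_vec \<zeta>) $ i" for i
    proof -
      have "real_vec \<xi> $ i = real_vec \<zeta> \<bullet> (matrix_inv M *v axis i 1)"
        by (simp add: \<xi>[symmetric] t_def inner_commute real_vec_def)
      also have "\<dots> = (transpose (matrix_inv M) *v real_vec \<zeta>) \<bullet> axis i 1"
        by (simp add: dot_lmul_matrix)
      finally show ?thesis by (simp add: inner_axis)
    qed
    then show ?thesis by (simp add: vec_eq_iff)
  qed
  then have "real_vec (dual A \<xi>) = (transpose M ** transpose (matrix_inv M)) *v real_vec \<zeta>"
    by (simp add: real_vec_dual M_def matrix_vector_mul_assoc del: transpose_matrix_vector)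
  also have "\<dots> = real_vec \<zeta>"
    by (simp add: matrix_transpose_mul[symmetric] MI transpose_mat del: transpose_matrix_vector)
  finally have d: "dual A \<xi> = \<zeta>" by (simp add: real_vec_inject)
  with \<open>\<zeta> \<noteq> 0\<close> have "\<xi> \<noteq> 0" by auto
  moreover have "L2_inner u (character \<xi>) \<noteq> 0"
    using koopman_inner[OF T u character_zero_mean[OF \<open>\<xi> \<noteq> 0\<close>]] ne d
    by (simp add: koopman_character)
  ultimately show thesis using d that by blast
qed

lemma koopman_pow_inner_character:
  fixes A :: "int ^ 'd::finite ^ 'd"
  assumes A: "det A \<noteq> 0" and T: "isometry_op (koopman A)" and u: "u \<in> L2_zero_mean"
  shows "L2_inner ((koopman A ^^ n) u) (character \<zeta>) \<noteq> 0 \<Longrightarrow>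
    \<exists>\<xi>. (dual A ^^ n) \<xi> = \<zeta> \<and> L2_inner u (character \<xi>) \<noteq> 0"
proof (induction n arbitrary: \<zeta>)
  case (Suc n)
  then have "L2_inner (koopman A ((koopman A ^^ n) u)) (character \<zeta>) \<noteq> 0" by simp
  then obtain \<zeta>' where "dual A \<zeta>' = \<zeta>" "L2_inner ((koopman A ^^ n) u) (character \<zeta>') \<noteq> 0"
    using koopman_inner_character[OF A T koopman_pow_zero_mean[OF T u]] by metis
  with Suc.IH[of \<zeta>'] show ?case by auto
qed simp

section \<open>Levels of frequencies\<close>

text \<open>For \<open>\<zeta> \<noteq> 0\<close>, level \<open>k\<close> means that the character of \<open>\<zeta>\<close> lies in \<open>T\<^sup>k V\<^sub>E\<close>.\<close>

definition level :: "int ^ 'd ^ 'd \<Rightarrow> (int ^ 'd) set \<Rightarrow> int \<Rightarrow> int ^ 'd \<Rightarrow> bool" where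
  "level A E k \<zeta> \<longleftrightarrow>
    (if 0 \<le> k then \<exists>\<xi>\<in>E. \<zeta> = (dual A ^^ nat k) \<xi> else (dual A ^^ nat (- k)) \<zeta> \<in> E)"

text \<open>The two branches of \<open>level\<close> meet at \<open>k = -1\<close>: there
  \<open>dual A \<zeta>\<close> itself lies in \<open>E\<close> and is its own witness for level
  0.\<close>

lemma level_dual:
  assumes "level A E k \<zeta>"
  shows "level A E (k + 1) (dual A \<zeta>)"
proof -
  consider "0 \<le> k" | "k = -1" | "k < -1" by linarith
  then show ?thesis
  proof cases
    case 1
    then have "nat (k + 1) = Suc (nat k)" by simp
    then show ?thesis using assms 1 by (auto simp: level_def)
  next
    case 2
    then show ?thesis using assms by (simp add: level_def)
  next
    case 3
    then have "nat (- k) = Suc (nat (- (k + 1)))" by simp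
    then show ?thesis using assms 3 by (simp add: level_def funpow_swap1)
  qed
qed

lemma character_in_spectral_subspace:
  "\<xi> \<in> E \<Longrightarrow> \<xi> \<noteq> 0 \<Longrightarrow> character \<xi> \<in> spectral_subspace E"
  by (auto simp: spectral_subspace_def character_zero_mean fourier_coeff_eq_inner inner_character)

text \<open>With \<open>op_image_level\<close> this identifies the combinatorial
  \<open>level\<close> with the position of a character among the shifted subspaces. Excluding 0
  from \<open>E\<close> keeps the characters in the space of vanishing mean.\<close>

lemma level_op_image:
  assumes "level A E k \<zeta>" "0 \<notin> E" "\<zeta> \<noteq> 0"
  shows "character \<zeta> \<in> op_image (koopman A) k (spectral_subspace E)"
proof (cases "0 \<le> k")
  case True
  with assms(1) obtain \<xi> where \<xi>: "\<xi> \<in> E" "\<zeta> = (dual A ^^ nat k) \<xi>"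
    by (auto simp: level_def)
  have "\<xi> \<noteq> 0" using \<xi>(1) assms(2) by metis
  then have "character \<xi> \<in> spectral_subspace E"
    using \<xi>(1) by (rule character_in_spectral_subspace[rotated])
  then show ?thesis
    unfolding op_image_def \<xi>(2) koopman_pow_character[symmetric] using True by simp
next
  case False
  with assms(1) have E: "(dual A ^^ nat (- k)) \<zeta> \<in> E"
    by (simp add: level_def)
  then have "character ((dual A ^^ nat (- k)) \<zeta>) \<in> spectral_subspace E"
    using assms(2) by (metis character_in_spectral_subspace)
  then show ?thesis
    using False assms(3) by (auto simp: op_image_def koopman_pow_character character_zero_mean)
qed

text \<open>A character with two levels would lie in two orthogonal subspaces and hence be
  orthogonal to itself.\<close>

lemma level_unique:
  assumes "generating_wandering Y (koopman A) (spectral_subspace E)" "0 \<notin> E" "\<zeta> \<noteq> 0"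
    and "level A E k \<zeta>" "k \<in> Y" "level A E m \<zeta>" "m \<in> Y"
  shows "k = m"
proof (rule ccontr)
  assume "k \<noteq> m"
  moreover have "character \<zeta> \<in> op_image (koopman A) k (spectral_subspace E)"
    and "character \<zeta> \<in> op_image (koopman A) m (spectral_subspace E)"
    using assms by (intro level_op_image; simp)+
  ultimately have "L2_inner (character \<zeta>) (character \<zeta>) = 0"
    using assms(1,5,7) unfolding generating_wandering_def by blast
  then show False by (simp add: inner_character)
qed

lemma op_image_zero_mean:
  assumes "isometry_op (koopman A)" "V \<subseteq> L2_zero_mean"
  shows "op_image (koopman A) k V \<subseteq> L2_zero_mean"
proof (cases "0 \<le> k")
  case True
  then show ?thesis
    using assms(2) koopman_pow_zero_mean[OF assms(1)] by (simp add: op_image_def) blast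
qed (auto simp: op_image_def)

text \<open>For negative \<open>k\<close>, membership in \<open>op_image\<close> is an equation up
  to null sets, which Fourier coefficients do not see.\<close>

lemma L2_inner_cong_AE:
  assumes "AE x in torus. f x = g x" "f \<in> L2" "g \<in> L2" "h \<in> L2"
  shows "L2_inner f h = L2_inner g h"
  unfolding L2_inner_def
proof (rule integral_cong_AE)
  show "AE x in torus. f x * cnj (h x) = g x * cnj (h x)"
    using assms(1) by eventually_elim simp
qed (use assms in \<open>simp_all add: borel_measurable_integrable[OF L2_mult_integrable] L2_cnj\<close>)

text \<open>For \<open>k \<ge> 0\<close>, composition with powers of \<open>A\<close> moves spectra
  by powers of the dual map. For \<open>k < 0\<close>, a power of the isometry pushes the function
  into the wandering subspace and carries its coefficient at \<zeta> to the one at the image of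
  \<zeta> under the dual power.\<close>

lemma op_image_level:
  assumes A: "det A \<noteq> 0" and T: "isometry_op (koopman A)" and "\<zeta> \<noteq> 0"
    and w: "w \<in> op_image (koopman A) k (spectral_subspace E)"
    and ne: "L2_inner w (character \<zeta>) \<noteq> 0"
  shows "level A E k \<zeta>"
proof (cases "0 \<le> k")
  case True
  with w obtain v where v: "v \<in> spectral_subspace E" "w = (koopman A ^^ nat k) v"
    by (auto simp: op_image_def)
  then have "v \<in> L2_zero_mean" by (simp add: spectral_subspace_def)
  from koopman_pow_inner_character[OF A T this] ne v(2)
  obtain \<xi> where "(dual A ^^ nat k) \<xi> = \<zeta>" "L2_inner v (character \<xi>) \<noteq> 0" by blast
  then show ?thesis
    using v(1) True by (auto simp: level_def spectral_subspace_def fourier_coeff_eq_inner)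
next
  case False
  let ?n = "nat (- k)"
  from w False obtain v where w0: "w \<in> L2_zero_mean" and v: "v \<in> spectral_subspace E"
    and ae: "AE x in torus. (koopman A ^^ ?n) w x = v x"
    by (auto simp: op_image_def)
  have "L2_inner v (character ((dual A ^^ ?n) \<zeta>)) =
      L2_inner ((koopman A ^^ ?n) w) (character ((dual A ^^ ?n) \<zeta>))"
    using v koopman_pow_zero_mean[OF T w0, of ?n] ae
    by (intro L2_inner_cong_AE[symmetric])
       (auto simp: spectral_subspace_def L2_zero_mean_def character_L2)
  also have "\<dots> = L2_inner w (character \<zeta>)"
    using koopman_pow_inner[OF T w0 character_zero_mean[OF \<open>\<zeta> \<noteq> 0\<close>]]
    by (simp add: koopman_pow_character)
  finally show ?thesis
    using ne v False by (auto simp: level_def spectral_subspace_def fourier_coeff_eq_inner)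
qed

text \<open>Without a level in \<open>Y\<close>, the frequency would be absent from every component,
  so the character would be orthogonal to all partial sums of its own decomposition and stay at
  distance at least 1 from them.\<close>

lemma level_exists:
  assumes A: "det A \<noteq> 0" and T: "isometry_op (koopman A)"
    and W: "generating_wandering Y (koopman A) (spectral_subspace E)" and "\<zeta> \<noteq> 0"
  shows "\<exists>k\<in>Y. level A E k \<zeta>"
proof (rule ccontr)
  assume none: "\<not> (\<exists>k\<in>Y. level A E k \<zeta>)"
  let ?e = "character \<zeta>"
  from W character_zero_mean[OF \<open>\<zeta> \<noteq> 0\<close>] obtain w
    where w: "\<And>k. k \<in> Y \<Longrightarrow> w k \<in> op_image (koopman A) k (spectral_subspace E)"
      and sum: "L2_has_sum w ?e Y"
    unfolding generating_wandering_def by metis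
  have V: "spectral_subspace E \<subseteq> L2_zero_mean" by (auto simp: spectral_subspace_def)
  have wL2: "w k \<in> L2" if "k \<in> Y" for k
    using op_image_zero_mean[OF T V] w[OF that] by (auto simp: L2_zero_mean_def)
  have orth: "L2_inner (w k) ?e = 0" if "k \<in> Y" for k
    using op_image_level[OF A T \<open>\<zeta> \<noteq> 0\<close> w[OF that]] none that by blast
  have ge: "L2_norm (\<lambda>x. ?e x - (\<Sum>k\<in>F. w k x)) \<ge> 1" if "finite F" "F \<subseteq> Y" for F
  proof -
    let ?s = "\<lambda>x. \<Sum>k\<in>F. w k x"
    have s: "?s \<in> L2" using wL2 that by (intro L2_sum) auto
    have "L2_inner ?s ?e = 0"
      using wL2 orth that by (subst L2_inner_sum_left) (auto simp: character_L2 intro!: sum.neutral)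
    then have "(L2_norm (\<lambda>x. ?s x + (-1) * ?e x))\<^sup>2 = (L2_norm ?s)\<^sup>2 + (L2_norm ?e)\<^sup>2"
      using L2_norm_square_lincomb[OF s character_L2, of "-1" \<zeta>] by simp
    moreover have "(L2_norm ?e)\<^sup>2 = 1"
      by (simp add: L2_norm_square)
    moreover have "L2_norm (\<lambda>x. ?s x + (-1) * ?e x) = L2_norm (\<lambda>x. ?e x - ?s x)"
      by (simp add: L2_norm_def norm_minus_commute)
    ultimately have "(L2_norm (\<lambda>x. ?e x - ?s x))\<^sup>2 \<ge> 1\<^sup>2" by simp
    then show ?thesis by (rule power2_le_imp_le) (rule L2_norm_nonneg)
  qed
  have "\<forall>\<^sub>F F in finite_subsets_at_top Y. L2_norm (\<lambda>x. ?e x - (\<Sum>k\<in>F. w k x)) < 1"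
    using sum unfolding L2_has_sum_def by (rule order_tendstoD) simp
  moreover have "\<forall>\<^sub>F F in finite_subsets_at_top Y. finite F \<and> F \<subseteq> Y"
    by (simp add: eventually_finite_subsets_at_top_weakI)
  ultimately have "\<forall>\<^sub>F F in finite_subsets_at_top Y. False"
    by eventually_elim (use ge in force)
  then show False by (simp add: trivial_limit_def[symmetric])
qed

section \<open>Lower bounds for the frequencies of a given level\<close>

lemma matrix_inv_pow_cancel:
  fixes M :: "real ^ 'd ^ 'd"
  assumes "invertible M"
  shows "((*v) (matrix_inv M) ^^ n) (((*v) M ^^ n) v) = v"
proof (induction n arbitrary: v)
  case (Suc n)
  have "matrix_inv M *v (M *v u) = u" for u
    using assms by (simp add: matrix_vector_mul_assoc matrix_inv_cancel)
  then have "((*v) (matrix_inv M) ^^ Suc n) (((*v) M ^^ Suc n) v) =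
      ((*v) (matrix_inv M) ^^ n) (((*v) M ^^ n) v)"
    by (simp add: funpow_swap1[of "(*v) (matrix_inv M)"])
  with Suc show ?case by simp
qed simp

lemma real_vec_dual_pow: "real_vec ((dual A ^^ n) \<xi>) = (((*v) (transpose (real_mat A))) ^^ n) (real_vec \<xi>)"
  by (induction n) (simp_all add: real_vec_dual del: transpose_matrix_vector)

text \<open>A frequency of level \<open>k\<close> is the image of some \<xi> in \<open>E\<close>
  under the k-th power of the transpose, where for negative \<open>k\<close> the inverse is that of
  the real matrix. The bound on orbits of \<open>E\<close> thus passes to \<zeta>.\<close>

lemma level_norm:
  assumes A: "det A \<noteq> 0" and "level A E k \<zeta>"
    and "\<And>\<xi>. \<xi> \<in> E \<Longrightarrow> norm (mat_powi_vec (transpose (real_mat A)) k (real_vec \<xi>)) \<ge> b"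
  shows "norm (real_vec \<zeta>) \<ge> b"
proof (cases "0 \<le> k")
  case True
  then show ?thesis
    using assms(2,3) by (auto simp: level_def mat_powi_vec_def real_vec_dual_pow)
next
  case False
  have inv: "invertible (transpose (real_mat A))"
    using A by (simp add: invertible_det_nz det_transpose det_real_mat)
  show ?thesis
    using assms(2) assms(3)[of "(dual A ^^ nat (- k)) \<zeta>"] False
    by (simp add: level_def mat_powi_vec_def real_vec_dual_pow matrix_inv_pow_cancel[OF inv])
qed

section \<open>Norms of sums along an orbit\<close>

text \<open>The frequencies \<open>g i\<close> may repeat: the Gram matrix of these characters has
  entry 1 where two indices share a frequency and 0 elsewhere.\<close>

lemma L2_norm_trig_sum_le:
  fixes g :: "'i \<Rightarrow> int ^ 'd::finite"
  assumes "finite P"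
  shows "(L2_norm (\<lambda>x. \<Sum>i\<in>P. c i * character (g i) x))\<^sup>2 \<le>
    (\<Sum>i\<in>P. \<Sum>j\<in>P. if g i = g j then norm (c i) * norm (c j) else 0)"
proof -
  let ?h = "\<lambda>x. \<Sum>i\<in>P. c i * character (g i) x"
  let ?t = "\<lambda>i j x. c i * cnj (c j) * (character (g i) x * cnj (character (g j) x))"
  have int: "integrable torus (?t i j)" for i j
    by (intro integrable_mult_right L2_mult_integrable L2_cnj character_L2)
  have "complex_of_real ((L2_norm ?h)\<^sup>2) = (LINT x|torus. ?h x * cnj (?h x))"
    by (simp only: L2_norm_square integral_complex_of_real[symmetric] complex_norm_square)
  also have "\<dots> = (LINT x|torus. (\<Sum>i\<in>P. \<Sum>j\<in>P. ?t i j x))"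
    unfolding cnj_sum sum_product by (simp only: complex_cnj_mult mult_ac)
  also have "\<dots> = (\<Sum>i\<in>P. \<Sum>j\<in>P. c i * cnj (c j) * L2_inner (character (g i)) (character (g j)))"
    using int by (simp add: L2_inner_def)
  finally have prod_eq: "complex_of_real ((L2_norm ?h)\<^sup>2) =
      (\<Sum>i\<in>P. \<Sum>j\<in>P. c i * cnj (c j) * L2_inner (character (g i)) (character (g j)))" .
  have "(L2_norm ?h)\<^sup>2 =
      norm (\<Sum>i\<in>P. \<Sum>j\<in>P. c i * cnj (c j) * L2_inner (character (g i)) (character (g j)))"
    unfolding prod_eq[symmetric] norm_of_real by simp
  also have "\<dots> \<le> (\<Sum>i\<in>P. \<Sum>j\<in>P. norm (c i * cnj (c j) * L2_inner (character (g i)) (character (g j))))"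
    by (intro order_trans[OF norm_sum] sum_mono norm_sum)
  also have "\<dots> = (\<Sum>i\<in>P. \<Sum>j\<in>P. if g i = g j then norm (c i) * norm (c j) else 0)"
    by (intro sum.cong refl) (simp add: inner_character norm_mult)
  finally show ?thesis .
qed

lemma weighted_AM_GM:
  fixes u v r s :: real
  assumes "r > 0" "s > 0"
  shows "u * v \<le> (u\<^sup>2 * r / s + v\<^sup>2 * s / r) / 2"
proof -
  have "0 \<le> (u * r - v * s)\<^sup>2" by simp
  then show ?thesis using assms by (simp add: field_simps power2_eq_square)
qed

text \<open>Schur's test, with weights \<open>r\<close>, for the Gram matrix of the characters \<open>g i\<close>.\<close>

lemma L2_norm_trig_sum_weighted:
  fixes g :: "'i \<Rightarrow> int ^ 'd::finite"
  assumes P: "finite P" and r: "\<And>i. i \<in> P \<Longrightarrow> r i > 0"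
    and R: "\<And>i. i \<in> P \<Longrightarrow> (\<Sum>j | j \<in> P \<and> g i = g j. 1 / r j) \<le> R"
  shows "(L2_norm (\<lambda>x. \<Sum>i\<in>P. c i * character (g i) x))\<^sup>2 \<le> R * (\<Sum>i\<in>P. r i * (norm (c i))\<^sup>2)"
proof -
  \<comment> \<open>\<open>(?s i j + ?s j i) / 2\<close> is the AM-GM bound of an entry. Both halves
    have the same double sum, and summing \<open>?s i j\<close> over \<open>j\<close> leaves the
    reciprocal weights on one fibre of \<open>g\<close>.\<close>
  let ?s = "\<lambda>i j. if g i = g j then (norm (c i))\<^sup>2 * r i / r j else 0"
  have "(\<Sum>i\<in>P. \<Sum>j\<in>P. if g i = g j then norm (c i) * norm (c j) else 0) \<le>
      (\<Sum>i\<in>P. \<Sum>j\<in>P. (?s i j + ?s j i) / 2)"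
  proof (intro sum_mono)
    fix i j assume "i \<in> P" "j \<in> P"
    then show "(if g i = g j then norm (c i) * norm (c j) else 0) \<le> (?s i j + ?s j i) / 2"
      using weighted_AM_GM[of "r i" "r j" "norm (c i)" "norm (c j)"] r by simp
  qed
  also have "\<dots> = ((\<Sum>i\<in>P. \<Sum>j\<in>P. ?s i j) + (\<Sum>i\<in>P. \<Sum>j\<in>P. ?s j i)) / 2"
    by (simp only: sum.distrib sum_divide_distrib[symmetric])
  also have "(\<Sum>i\<in>P. \<Sum>j\<in>P. ?s j i) = (\<Sum>i\<in>P. \<Sum>j\<in>P. ?s i j)"
    by (rule sum.swap)
  also have "((\<Sum>i\<in>P. \<Sum>j\<in>P. ?s i j) + (\<Sum>i\<in>P. \<Sum>j\<in>P. ?s i j)) / 2 = (\<Sum>i\<in>P. \<Sum>j\<in>P. ?s i j)"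
    by simp
  also have "\<dots> = (\<Sum>i\<in>P. r i * (norm (c i))\<^sup>2 * (\<Sum>j | j \<in> P \<and> g i = g j. 1 / r j))"
    using P by (intro sum.cong refl) (auto simp: sum_distrib_left sum.inter_filter mult_ac intro!: sum.cong)
  also have "\<dots> \<le> (\<Sum>i\<in>P. r i * (norm (c i))\<^sup>2 * R)"
    using r R by (intro sum_mono mult_left_mono) (auto simp: less_imp_le)
  also have "\<dots> = R * (\<Sum>i\<in>P. r i * (norm (c i))\<^sup>2)"
    by (simp add: sum_distrib_left mult_ac)
  finally show ?thesis using L2_norm_trig_sum_le[OF P, of c g] by linarith
qed

lemma int_weight_sum_bounded:
  fixes \<delta> :: real
  assumes "\<delta> > 0"
  obtains R where "R > 0"
    "\<And>J :: int set. finite J \<Longrightarrow> (\<Sum>j\<in>J. 1 / (1 + real_of_int \<bar>j\<bar>) powr (1 + \<delta>)) \<le> R"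
proof -
  define h where "h n = 1 / (1 + real n) powr (1 + \<delta>)" for n
  have "summable (\<lambda>n. real n powr (- (1 + \<delta>)))"
    using assms by (simp add: summable_real_powr_iff)
  then have "summable (\<lambda>n. real (Suc n) powr (- (1 + \<delta>)))"
    by (subst summable_Suc_iff)
  moreover have "h = (\<lambda>n. real (Suc n) powr (- (1 + \<delta>)))"
    unfolding h_def powr_minus by (simp add: divide_inverse)
  ultimately have summ: "summable h" by simp
  have hpos: "h n \<ge> 0" for n by (simp add: h_def)
  have fin: "sum h N \<le> suminf h" if "finite N" for N
    using summ that by (rule sum_le_suminf) (simp add: hpos)
  \<comment> \<open>Twice the series over the naturals covers both signs of \<open>j\<close>; the
    added 1 makes the bound strictly positive.\<close>
  show thesis
  proof (rule that[of "2 * suminf h + 1"])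
    show "2 * suminf h + 1 > 0" using fin[of "{}"] by simp
    fix J :: "int set" assume J: "finite J"
    let ?N = "(nat \<circ> abs) ` J"
    let ?g = "\<lambda>j. h (nat \<bar>j\<bar>)"
    have N: "finite ?N" using J by simp
    have sub: "J \<subseteq> int ` ?N \<union> (\<lambda>n. - int n) ` ?N"
    proof
      fix j assume "j \<in> J"
      then have "nat \<bar>j\<bar> \<in> ?N" by auto
      moreover have "j = int (nat \<bar>j\<bar>) \<or> j = - int (nat \<bar>j\<bar>)" by auto
      ultimately show "j \<in> int ` ?N \<union> (\<lambda>n. - int n) ` ?N" by blast
    qed
    have "(\<Sum>j\<in>J. 1 / (1 + real_of_int \<bar>j\<bar>) powr (1 + \<delta>)) = sum ?g J"
      by (simp add: h_def)
    also have "\<dots> \<le> sum ?g (int ` ?N \<union> (\<lambda>n. - int n) ` ?N)"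
      using N sub hpos by (intro sum_mono2) auto
    also have "\<dots> \<le> sum ?g (int ` ?N) + sum ?g ((\<lambda>n. - int n) ` ?N)"
      using N hpos sum.union_inter[of "int ` ?N" "(\<lambda>n. - int n) ` ?N" ?g]
        sum_nonneg[of "int ` ?N \<inter> (\<lambda>n. - int n) ` ?N" ?g] by simp
    also have "\<dots> = sum h ?N + sum h ?N"
      by (subst (1 2) sum.reindex) (auto simp: inj_on_def)
    also have "\<dots> \<le> 2 * suminf h + 1" using fin[OF N] by simp
    finally show "(\<Sum>j\<in>J. 1 / (1 + real_of_int \<bar>j\<bar>) powr (1 + \<delta>)) \<le> 2 * suminf h + 1" .
  qed
qed

text \<open>The sum is indexed by pairs of an exponent n and a frequency \<zeta>. The weight depends
  on \<zeta> only, so summation over n costs just a factor \<open>card I\<close>: the growth is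
  linear, not quadratic.\<close>

lemma L2_norm_orbit_sum_le:
  fixes A :: "int ^ 'd::finite ^ 'd" and \<kappa> :: "int ^ 'd \<Rightarrow> int"
  assumes A: "det A \<noteq> 0" and \<kappa>: "\<And>\<zeta>. \<zeta> \<noteq> 0 \<Longrightarrow> \<kappa> (dual A \<zeta>) = \<kappa> \<zeta> + 1"
    and \<rho>: "\<And>k. \<rho> k > 0" and R: "\<And>J. finite J \<Longrightarrow> (\<Sum>j\<in>J. 1 / \<rho> j) \<le> R"
    and fin: "finite I" "finite F" and F0: "0 \<notin> F"
  shows "(L2_norm (\<lambda>x. \<Sum>n\<in>I. (koopman A ^^ n) (\<lambda>y. \<Sum>\<zeta>\<in>F. a \<zeta> * character \<zeta> y) x))\<^sup>2 \<le>
    R * real (card I) * (\<Sum>\<zeta>\<in>F. \<rho> (\<kappa> \<zeta>) * (norm (a \<zeta>))\<^sup>2)"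
proof -
  define g where "g p = (dual A ^^ fst p) (snd p)" for p :: "nat \<times> (int ^ 'd)"
  have \<kappa>g: "\<kappa> (g p) = \<kappa> (snd p) + int (fst p)" if "snd p \<noteq> 0" for p
  proof -
    have "\<kappa> ((dual A ^^ n) \<zeta>) = \<kappa> \<zeta> + int n" if "\<zeta> \<noteq> 0" for n \<zeta>
      using that by (induction n) (simp_all add: \<kappa> dual_pow_eq_0_iff[OF A])
    then show ?thesis using that by (simp add: g_def)
  qed
  have "(\<Sum>n\<in>I. (koopman A ^^ n) (\<lambda>y. \<Sum>\<zeta>\<in>F. a \<zeta> * character \<zeta> y) x) =
      (\<Sum>p\<in>I \<times> F. a (snd p) * character (g p) x)" for x
    by (simp add: koopman_pow sum.cartesian_product' g_def flip: koopman_pow_character)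
  then have "(L2_norm (\<lambda>x. \<Sum>n\<in>I. (koopman A ^^ n) (\<lambda>y. \<Sum>\<zeta>\<in>F. a \<zeta> * character \<zeta> y) x))\<^sup>2 =
      (L2_norm (\<lambda>x. \<Sum>p\<in>I \<times> F. a (snd p) * character (g p) x))\<^sup>2"
    by simp
  also have "\<dots> \<le> R * (\<Sum>p\<in>I \<times> F. \<rho> (\<kappa> (snd p)) * (norm (a (snd p)))\<^sup>2)"
  proof (rule L2_norm_trig_sum_weighted)
    fix p assume p: "p \<in> I \<times> F"
    let ?J = "{p'. p' \<in> I \<times> F \<and> g p = g p'}"
    \<comment> \<open>Each step of an orbit raises the level by one, so pairs meeting in one
      frequency with equal starting levels have equal exponents, and injectivity of the dual power
      gives equal starting points. The reciprocal weights on a fibre are therefore summed over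
      distinct levels.\<close>
    have "inj_on (\<lambda>p'. \<kappa> (snd p')) ?J"
    proof (rule inj_onI)
      fix u v assume uv: "u \<in> ?J" "v \<in> ?J" "\<kappa> (snd u) = \<kappa> (snd v)"
      then have "snd u \<noteq> 0" "snd v \<noteq> 0" and g: "g u = g v" using F0 by auto
      then have n: "fst u = fst v" using \<kappa>g[of u] \<kappa>g[of v] uv(3) by simp
      then have "snd u = snd v"
        using g injD[OF inj_dual_pow[OF A, of "fst u"]] by (simp add: g_def)
      with n show "u = v" by (simp add: prod_eq_iff)
    qed
    then have "(\<Sum>p'\<in>?J. 1 / \<rho> (\<kappa> (snd p'))) = (\<Sum>j\<in>(\<lambda>p'. \<kappa> (snd p')) ` ?J. 1 / \<rho> j)"
      by (simp add: sum.reindex)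
    also have "\<dots> \<le> R"
      using fin by (intro R finite_imageI finite_subset[of ?J "I \<times> F"]) auto
    finally show "(\<Sum>p'\<in>?J. 1 / \<rho> (\<kappa> (snd p'))) \<le> R" .
  qed (use fin \<rho> in auto)
  also have "(\<Sum>p\<in>I \<times> F. \<rho> (\<kappa> (snd p)) * (norm (a (snd p)))\<^sup>2) =
      real (card I) * (\<Sum>\<zeta>\<in>F. \<rho> (\<kappa> \<zeta>) * (norm (a \<zeta>))\<^sup>2)"
    by (simp add: sum.cartesian_product')
  finally show ?thesis by (simp add: mult.assoc)
qed

section \<open>From trigonometric polynomials to ergodic sums of \<open>f\<close>\<close>

lemma L2_norm_add_square_le:
  assumes "f \<in> L2" "g \<in> L2"
  shows "(L2_norm (\<lambda>x. f x + g x))\<^sup>2 \<le> 2 * (L2_norm f)\<^sup>2 + 2 * (L2_norm g)\<^sup>2"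
proof -
  have "(L2_norm (\<lambda>x. f x + g x))\<^sup>2 + (L2_norm (\<lambda>x. f x + (-1) * g x))\<^sup>2 =
      2 * (L2_norm f)\<^sup>2 + 2 * (L2_norm g)\<^sup>2"
    using L2_norm_square_lincomb[OF assms, of 1] L2_norm_square_lincomb[OF assms, of "-1"] by simp
  then show ?thesis using zero_le_power2[of "L2_norm (\<lambda>x. f x + (-1) * g x)"] by linarith
qed

lemma norm_sum_square_le:
  fixes z :: "'i \<Rightarrow> 'a::real_normed_vector"
  shows "(norm (\<Sum>i\<in>I. z i))\<^sup>2 \<le> real (card I) * (\<Sum>i\<in>I. (norm (z i))\<^sup>2)"
proof -
  have "(norm (\<Sum>i\<in>I. z i))\<^sup>2 \<le> (\<Sum>i\<in>I. norm (z i))\<^sup>2"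
    by (intro power_mono norm_sum norm_ge_zero)
  also have "\<dots> \<le> real (card I) * (\<Sum>i\<in>I. (norm (z i))\<^sup>2)"
    using sum_squared_le_sum_of_squares[of "\<lambda>i. norm (z i)" I] by (simp add: mult.commute)
  finally show ?thesis .
qed

lemma L2_norm_sum_square_le:
  assumes "\<And>i. i \<in> I \<Longrightarrow> w i \<in> L2"
  shows "(L2_norm (\<lambda>x. \<Sum>i\<in>I. w i x))\<^sup>2 \<le> real (card I) * (\<Sum>i\<in>I. (L2_norm (w i))\<^sup>2)"
proof -
  have "(L2_norm (\<lambda>x. \<Sum>i\<in>I. w i x))\<^sup>2 \<le>
      (LINT x|torus. real (card I) * (\<Sum>i\<in>I. (norm (w i x))\<^sup>2))"
    unfolding L2_norm_square
  proof (rule integral_mono)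
    show "integrable torus (\<lambda>x. (norm (\<Sum>i\<in>I. w i x))\<^sup>2)"
      using L2_sum[of I w] assms by (simp add: L2_def)
    show "integrable torus (\<lambda>x. real (card I) * (\<Sum>i\<in>I. (norm (w i x))\<^sup>2))"
      using assms by (simp add: L2_def)
  qed (rule norm_sum_square_le)
  then show ?thesis using assms by (simp add: L2_norm_square L2_def)
qed

lemma L2_zero_mean_centred:
  assumes "f \<in> L2"
  shows "(\<lambda>x. f x - (LINT y|torus. f y)) \<in> L2_zero_mean"
  using L2_lincomb[OF assms L2_const[of "LINT y|torus. f y"], of 1 "-1"] L2_integrable[OF assms]
  by (simp add: L2_zero_mean_def)

text \<open>The orbit estimate applies to a trigonometric polynomial close to \<open>g\<close>; the
  remainder is so small that the crude bound with the square of \<open>card I\<close> suffices for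
  it. The factor 2 comes from splitting the square of the norm.\<close>

lemma L2_norm_ergodic_sum_le:
  fixes A :: "int ^ 'd::finite ^ 'd" and \<kappa> :: "int ^ 'd \<Rightarrow> int"
  assumes A: "det A \<noteq> 0" and T: "isometry_op (koopman A)"
    and \<kappa>: "\<And>\<zeta>. \<zeta> \<noteq> 0 \<Longrightarrow> \<kappa> (dual A \<zeta>) = \<kappa> \<zeta> + 1"
    and \<rho>: "\<And>k. \<rho> k > 0" and R: "R > 0" "\<And>J. finite J \<Longrightarrow> (\<Sum>j\<in>J. 1 / \<rho> j) \<le> R"
    and f: "f \<in> L2" and sum: "L2_has_sum (\<lambda>\<xi> x. fourier_coeff f \<xi> * character \<xi> x) f UNIV"
    and C: "\<And>F. finite F \<Longrightarrow> 0 \<notin> F \<Longrightarrow> (\<Sum>\<zeta>\<in>F. \<rho> (\<kappa> \<zeta>) * (norm (fourier_coeff f \<zeta>))\<^sup>2) \<le> C"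
    and I: "finite I"
  defines "g \<equiv> \<lambda>x. f x - (LINT y|torus. f y)"
  shows "(L2_norm (\<lambda>x. \<Sum>n\<in>I. (koopman A ^^ n) g x))\<^sup>2 \<le> 2 * R * C * real (card I)"
proof -
  let ?T = "\<lambda>n. koopman A ^^ n"
  have g0: "g \<in> L2_zero_mean"
    unfolding g_def by (rule L2_zero_mean_centred[OF f])
  have "(L2_norm (\<lambda>x. \<Sum>n\<in>I. ?T n g x))\<^sup>2 \<le> 2 * R * C * real (card I) + \<epsilon>" if "\<epsilon> > 0" for \<epsilon>
  proof -
    \<comment> \<open>Makes the square of \<open>card I\<close> times the squared norm of the
      remainder at most \<open>\<epsilon> / 2\<close>; the added 1 avoids division by zero for empty
      \<open>I\<close>.\<close>
    define \<epsilon>' where "\<epsilon>' = sqrt (\<epsilon> / (2 * (1 + real (card I))\<^sup>2))"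
    have "\<epsilon>' > 0" using that by (simp add: \<epsilon>'_def add_pos_nonneg)
    have "\<forall>\<^sub>F F in finite_subsets_at_top UNIV.
        L2_norm (\<lambda>x. f x - (\<Sum>\<xi>\<in>F. fourier_coeff f \<xi> * character \<xi> x)) < \<epsilon>'"
      using sum \<open>\<epsilon>' > 0\<close> unfolding L2_has_sum_def by (rule order_tendstoD)
    then obtain F0 where F0: "finite F0" and close: "\<And>F. finite F \<Longrightarrow> F0 \<subseteq> F \<Longrightarrow>
        L2_norm (\<lambda>x. f x - (\<Sum>\<xi>\<in>F. fourier_coeff f \<xi> * character \<xi> x)) < \<epsilon>'"
      unfolding eventually_finite_subsets_at_top by auto
    \<comment> \<open>The coefficient at 0 is the mean, already subtracted in \<open>g\<close>.
      Dropping 0 from the polynomial makes \<open>h\<close> the truncation error of \<open>f\<close>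
      over \<open>insert 0 F0\<close>.\<close>
    define F where "F = F0 - {0}"
    have F: "finite F" "0 \<notin> F" "insert 0 F = insert 0 F0" using F0 by (auto simp: F_def)
    define p where "p x = (\<Sum>\<xi>\<in>F. fourier_coeff f \<xi> * character \<xi> x)" for x
    define h where "h x = g x - p x" for x
    have p0: "p \<in> L2_zero_mean"
      unfolding p_def
    proof (rule L2_zero_mean_sum)
      fix \<xi> assume "\<xi> \<in> F"
      then have "\<xi> \<noteq> 0" using F by auto
      then show "(\<lambda>x. fourier_coeff f \<xi> * character \<xi> x) \<in> L2_zero_mean"
        using L2_zero_mean_lincomb[of "character \<xi>" "character \<xi>" "fourier_coeff f \<xi>" 0]
        by (simp add: character_zero_mean)
    qed
    have h0: "h \<in> L2_zero_mean"
      using L2_zero_mean_lincomb[OF g0 p0, of 1 "-1"] by (simp add: h_def[abs_def])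
    have "h = (\<lambda>x. f x - (\<Sum>\<xi>\<in>insert 0 F0. fourier_coeff f \<xi> * character \<xi> x))"
      unfolding F(3)[symmetric] using F(1,2)
      by (simp add: fun_eq_iff h_def g_def p_def character_0 fourier_coeff_eq_inner L2_inner_def)
    then have "L2_norm h < \<epsilon>'"
      using close[of "insert 0 F0"] F0 by (simp add: subset_insertI)
    then have "(L2_norm h)\<^sup>2 \<le> \<epsilon>'\<^sup>2"
      by (intro power_mono) (simp_all add: L2_norm_nonneg)
    also have "\<epsilon>'\<^sup>2 = \<epsilon> / (2 * (1 + real (card I))\<^sup>2)"
      using that by (simp add: \<epsilon>'_def)
    finally have h\<epsilon>: "(L2_norm h)\<^sup>2 \<le> \<epsilon> / (2 * (1 + real (card I))\<^sup>2)" .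
    have Tsum: "(\<lambda>x. \<Sum>n\<in>I. ?T n u x) \<in> L2" if "u \<in> L2_zero_mean" for u
      using koopman_pow_zero_mean[OF T that] by (intro L2_sum) (simp add: L2_zero_mean_def)
    have "(L2_norm (\<lambda>x. \<Sum>n\<in>I. ?T n g x))\<^sup>2 =
        (L2_norm (\<lambda>x. (\<Sum>n\<in>I. ?T n p x) + (\<Sum>n\<in>I. ?T n h x)))\<^sup>2"
      by (simp add: koopman_pow h_def flip: sum.distrib)
    also have "\<dots> \<le> 2 * (L2_norm (\<lambda>x. \<Sum>n\<in>I. ?T n p x))\<^sup>2 + 2 * (L2_norm (\<lambda>x. \<Sum>n\<in>I. ?T n h x))\<^sup>2"
      by (rule L2_norm_add_square_le[OF Tsum[OF p0] Tsum[OF h0]])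
    also have "(L2_norm (\<lambda>x. \<Sum>n\<in>I. ?T n p x))\<^sup>2 \<le> R * C * real (card I)"
    proof -
      have "(L2_norm (\<lambda>x. \<Sum>n\<in>I. ?T n p x))\<^sup>2 \<le>
          R * real (card I) * (\<Sum>\<zeta>\<in>F. \<rho> (\<kappa> \<zeta>) * (norm (fourier_coeff f \<zeta>))\<^sup>2)"
        unfolding p_def[abs_def] using A \<kappa> \<rho> R(2) I F(1,2) by (intro L2_norm_orbit_sum_le) auto
      also have "\<dots> \<le> R * real (card I) * C"
        using R(1) C[OF F(1,2)] by (intro mult_left_mono) auto
      finally show ?thesis by (simp add: mult_ac)
    qed
    also have "(L2_norm (\<lambda>x. \<Sum>n\<in>I. ?T n h x))\<^sup>2 \<le> \<epsilon> / 2"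
    proof -
      have "(L2_norm (\<lambda>x. \<Sum>n\<in>I. ?T n h x))\<^sup>2 \<le> real (card I) * (\<Sum>n\<in>I. (L2_norm (?T n h))\<^sup>2)"
        using koopman_pow_zero_mean[OF T h0]
        by (intro L2_norm_sum_square_le) (simp add: L2_zero_mean_def)
      also have "\<dots> = (real (card I))\<^sup>2 * (L2_norm h)\<^sup>2"
        by (simp add: koopman_pow_norm[OF T h0] power2_eq_square)
      also have "\<dots> \<le> (1 + real (card I))\<^sup>2 * (\<epsilon> / (2 * (1 + real (card I))\<^sup>2))"
        using that by (intro mult_mono h\<epsilon> power_mono) auto
      also have "\<dots> = \<epsilon> / 2" by (simp add: add_nonneg_eq_0_iff)
      finally show ?thesis .
    qed
    finally show ?thesis by (simp add: algebra_simps)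
  qed
  then show ?thesis by (rule field_le_epsilon)
qed

section \<open>The Rademacher--Menshov argument\<close>

text \<open>By monotone convergence the sum has finite integral, hence is finite almost
  everywhere.\<close>

lemma AE_summable_of_summable_integrals:
  fixes h :: "nat \<Rightarrow> 'a \<Rightarrow> real"
  assumes int: "\<And>m. integrable M (h m)" and nonneg: "\<And>m x. h m x \<ge> 0"
    and b: "\<And>m. (LINT x|M. h m x) \<le> b m" "summable b"
  shows "AE x in M. summable (\<lambda>m. h m x)"
proof -
  have meas: "(\<lambda>x. ennreal (h m x)) \<in> borel_measurable M" for m
    using int[of m] by measurable
  have b0: "b m \<ge> 0" for m
    using order_trans[OF Bochner_Integration.integral_nonneg[OF nonneg] b(1)] by blast
  have "(\<integral>\<^sup>+x. (\<Sum>m. ennreal (h m x)) \<partial>M) = (\<Sum>m. \<integral>\<^sup>+x. ennreal (h m x) \<partial>M)"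
    using meas by (rule nn_integral_suminf)
  also have "\<dots> = (\<Sum>m. ennreal (LINT x|M. h m x))"
    using int nonneg by (simp add: nn_integral_eq_integral)
  also have "\<dots> \<le> (\<Sum>m. ennreal (b m))"
    using b(1) by (intro suminf_le) (auto simp: ennreal_leI)
  also have "\<dots> = ennreal (suminf b)"
    using b0 b(2) by (rule suminf_ennreal2)
  finally have "(\<integral>\<^sup>+x. (\<Sum>m. ennreal (h m x)) \<partial>M) \<noteq> \<infinity>"
    by (auto simp: top_unique)
  then have "AE x in M. (\<Sum>m. ennreal (h m x)) \<noteq> \<infinity>"
    using meas by (intro nn_integral_PInf_AE) auto
  then show ?thesis
    by eventually_elim (use nonneg in \<open>auto intro!: summable_suminf_not_top\<close>)
qed

text \<open>Descending from \<open>N\<close> to \<open>0\<close> by clearing binary digits passes through at most one dyadic interval per scale.\<close>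

lemma norm_square_le_dyadic:
  fixes S :: "nat \<Rightarrow> 'a::real_normed_vector"
  assumes S0: "S 0 = 0" and N: "N \<le> 2 ^ m"
  shows "(norm (S N))\<^sup>2 \<le>
    real (m + 1) * (\<Sum>j\<le>m. \<Sum>i<2 ^ (m - j). (norm (S (Suc i * 2 ^ j) - S (i * 2 ^ j)))\<^sup>2)"
proof -
  \<comment> \<open>\<open>a j\<close> is \<open>N\<close> with its last \<open>j\<close> binary
    digits cleared, and \<open>d j\<close> is the increment lost by clearing the next one. The final
    term accounts for \<open>N = 2 ^ m\<close>, where \<open>a m\<close> is not 0.\<close>
  define a where "a j = N div 2 ^ j * 2 ^ j" for j
  define d where "d j = (if j < m then S (a j) - S (a (Suc j)) else S (a m))" for j
  let ?D = "\<lambda>j. \<Sum>i<2 ^ (m - j). (norm (S (Suc i * 2 ^ j) - S (i * 2 ^ j)))\<^sup>2"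
  have "(\<Sum>j<m. S (a j) - S (a (Suc j))) = S (a 0) - S (a m)"
    by (rule sum_lessThan_telescope')
  then have SN: "S N = (\<Sum>j\<le>m. d j)"
    by (simp add: d_def a_def lessThan_Suc_atMost[symmetric] del: lessThan_Suc_atMost)
  have step: "(norm (S (Suc i * 2 ^ j) - S (i * 2 ^ j)))\<^sup>2 \<le> ?D j" if "i < 2 ^ (m - j)" for i j
    using that by (intro member_le_sum[where f = "\<lambda>i. (norm (S (Suc i * 2 ^ j) - S (i * 2 ^ j)))\<^sup>2"]) auto
  have D0: "?D j \<ge> 0" for j by (intro sum_nonneg) simp
  have dD: "(norm (d j))\<^sup>2 \<le> ?D j" if "j \<le> m" for j
  proof (cases "j < m")
    case True
    define k where "k = N div 2 ^ j"
    have "k \<le> 2 ^ (m - j)"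
      using div_le_mono[OF N, of "2 ^ j"] that by (simp add: k_def power_diff)
    have k2: "N div 2 ^ Suc j = k div 2"
      unfolding k_def power_Suc2 by (rule div_mult2_eq)
    have aj: "a j = k * 2 ^ j" "a (Suc j) = k div 2 * 2 * 2 ^ j"
      unfolding a_def k2 by (simp_all add: k_def)
    show ?thesis
    proof (cases "even k")
      case True
      then have "a j = a (Suc j)" by (simp add: aj)
      then show ?thesis using \<open>j < m\<close> D0 by (simp add: d_def)
    next
      case False
      \<comment> \<open>For an odd quotient, clearing the digit removes exactly the dyadic block
        with the even index \<open>2 * i\<close>.\<close>
      then obtain i where i: "k = Suc (2 * i)" by (auto elim: oddE)
      then have "a j = Suc (2 * i) * 2 ^ j" "a (Suc j) = 2 * i * 2 ^ j"
        by (simp_all add: aj)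
      then show ?thesis
        using step[of "2 * i" j] \<open>j < m\<close> i \<open>k \<le> 2 ^ (m - j)\<close> by (simp add: d_def)
    qed
  next
    case False
    with that have j: "j = m" by simp
    have "a m = 0 \<or> a m = 2 ^ m"
      using N by (cases "N = 2 ^ m") (auto simp: a_def)
    then show ?thesis using step[of 0 m] D0[of m] S0 by (auto simp: d_def j)
  qed
  have "(norm (S N))\<^sup>2 \<le> real (card {..m}) * (\<Sum>j\<le>m. (norm (d j))\<^sup>2)"
    unfolding SN by (rule norm_sum_square_le)
  also have "\<dots> \<le> real (m + 1) * (\<Sum>j\<le>m. ?D j)"
  proof -
    have "(\<Sum>j\<le>m. (norm (d j))\<^sup>2) \<le> (\<Sum>j\<le>m. ?D j)"
      by (rule sum_mono) (rule dD, simp)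
    then show ?thesis unfolding card_atMost Suc_eq_plus1 by (intro mult_left_mono) auto
  qed
  finally show ?thesis .
qed

text \<open>\<open>G m\<close> controls all \<open>N\<close> up to \<open>2 ^ m\<close> at once, so
  each \<open>N\<close> may use the first power of two above it. Squaring turns the exponent
  \<open>3 / 2 + \<eta>\<close> into \<open>3 + 2 * \<eta>\<close>.\<close>

lemma tendsto_0_of_dyadic_bound:
  fixes S :: "nat \<Rightarrow> 'a::real_normed_field" and G :: "nat \<Rightarrow> real"
  assumes SG: "\<And>N m. N \<le> 2 ^ m \<Longrightarrow> (norm (S N))\<^sup>2 \<le> G m"
    and lim: "(\<lambda>m. G m / (2 ^ m * real (m + 1) powr (3 + 2 * \<eta>))) \<longlonglongrightarrow> 0" and \<eta>: "\<eta> > 0"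
  shows "(\<lambda>N. sqrt (real N) / ln (1 + real N) powr (3 / 2 + \<eta>) * norm (S N / of_nat N)) \<longlonglongrightarrow> 0"
proof -
  define h where "h m = G m / (2 ^ m * real (m + 1) powr (3 + 2 * \<eta>))" for m
  define X where "X N = sqrt (real N) / ln (1 + real N) powr (3 / 2 + \<eta>) * norm (S N / of_nat N)" for N
  \<comment> \<open>\<open>M N\<close> is the integer part of the binary logarithm; 0 has none,
    hence the guard.\<close>
  have "\<exists>m. N \<ge> 1 \<longrightarrow> 2 ^ m \<le> N \<and> N < 2 ^ Suc m" for N :: nat
    using ex_power_ivl1[of 2 N] by auto
  then obtain M :: "nat \<Rightarrow> nat"
    where M: "\<And>N. N \<ge> 1 \<Longrightarrow> 2 ^ M N \<le> N" "\<And>N. N \<ge> 1 \<Longrightarrow> N < 2 ^ Suc (M N)"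
    by metis
  \<comment> \<open>The 2 comes from \<open>2 ^ Suc (M N) \<le> 2 * N\<close>, and
    \<open>3 / ln 2\<close> from \<open>M N + 2 \<le> 3 / ln 2 * ln (1 + N)\<close>.\<close>
  define c where "c = 2 * (3 / ln 2) powr (3 + 2 * \<eta>)"
  have X2: "(X N)\<^sup>2 \<le> c * h (Suc (M N))" if N: "N \<ge> 1" for N
  proof -
    let ?m = "Suc (M N)" and ?L = "ln (1 + real N)"
    have L2: "?L \<ge> ln 2" using N by simp
    have Lpos: "?L > 0" using N by simp
    have MN: "2 ^ M N \<le> real N"
      using M(1)[OF N] by (metis of_nat_le_iff of_nat_numeral of_nat_power)
    have "ln (2 ^ M N) \<le> ?L"
      by (rule ln_mono) (use MN in linarith, simp)
    then have "real (M N) * ln 2 \<le> ?L" by (simp add: ln_realpow)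
    then have "real (?m + 1) * ln 2 \<le> 3 * ?L"
      using L2 by (simp add: distrib_right del: ln_le_cancel_iff)
    then have "real (?m + 1) \<le> 3 / ln 2 * ?L" by (simp add: field_simps)
    then have "real (?m + 1) powr (3 + 2 * \<eta>) \<le> (3 / ln 2 * ?L) powr (3 + 2 * \<eta>)"
      using \<eta> by (intro powr_mono2) auto
    also have "\<dots> = (3 / ln 2) powr (3 + 2 * \<eta>) * ?L powr (3 + 2 * \<eta>)"
      by (rule powr_mult)
    finally have mL: "real (?m + 1) powr (3 + 2 * \<eta>) \<le> (3 / ln 2) powr (3 + 2 * \<eta>) * ?L powr (3 + 2 * \<eta>)" .
    have LL: "(?L powr (3 / 2 + \<eta>))\<^sup>2 = ?L powr (3 + 2 * \<eta>)"
      using Lpos by (simp add: power2_eq_square flip: powr_add)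
    have "G ?m \<ge> 0"
      by (rule order_trans[OF zero_le_power2 SG[of 0]]) simp
    then have h0: "h ?m \<ge> 0" by (simp add: h_def)
    have "(X N)\<^sup>2 = real N / ?L powr (3 + 2 * \<eta>) * ((norm (S N))\<^sup>2 / (real N)\<^sup>2)"
      by (simp add: X_def power_mult_distrib power_divide norm_divide LL)
    also have "\<dots> = (norm (S N))\<^sup>2 / (real N * ?L powr (3 + 2 * \<eta>))"
      using N by (simp add: power2_eq_square)
    also have "\<dots> \<le> G ?m / (real N * ?L powr (3 + 2 * \<eta>))"
      using SG[of N ?m] M(2)[OF N] by (intro divide_right_mono) auto
    also have "G ?m = h ?m * (2 ^ ?m * real (?m + 1) powr (3 + 2 * \<eta>))"
      by (simp add: h_def)
    also have "h ?m * (2 ^ ?m * real (?m + 1) powr (3 + 2 * \<eta>)) / (real N * ?L powr (3 + 2 * \<eta>)) \<le>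
        h ?m * ((2 * real N) * ((3 / ln 2) powr (3 + 2 * \<eta>) * ?L powr (3 + 2 * \<eta>))) /
          (real N * ?L powr (3 + 2 * \<eta>))"
    proof -
      have "2 ^ ?m \<le> 2 * real N" using MN by simp
      then show ?thesis
        using mL h0 by (intro divide_right_mono mult_left_mono mult_mono) auto
    qed
    also have "\<dots> = c * h ?m"
      using N Lpos by (simp add: c_def)
    finally show ?thesis .
  qed
  have "filterlim M at_top at_top"
    unfolding filterlim_at_top
  proof
    fix Z :: nat
    have "Z \<le> M N" if "N \<ge> 2 ^ Z" for N
    proof -
      have "N \<ge> 1" using that by (meson one_le_numeral one_le_power order_trans)
      then have "(2::nat) ^ Z < 2 ^ Suc (M N)" using M(2) that by (meson le_less_trans)
      then have "Z < Suc (M N)" by (rule power_less_imp_less_exp[rotated]) simp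
      then show ?thesis by simp
    qed
    then show "\<forall>\<^sub>F N in sequentially. Z \<le> M N"
      using eventually_ge_at_top[of "2 ^ Z"] by (rule eventually_mono[rotated])
  qed
  then have "filterlim (\<lambda>N. Suc (M N)) sequentially sequentially"
    by (rule filterlim_compose[OF filterlim_Suc])
  then have "(\<lambda>N. h (Suc (M N))) \<longlonglongrightarrow> 0"
    by (rule filterlim_compose[OF lim[folded h_def]])
  then have "(\<lambda>N. sqrt (c * h (Suc (M N)))) \<longlonglongrightarrow> sqrt (c * 0)"
    by (intro tendsto_intros)
  then have "(\<lambda>N. sqrt (c * h (Suc (M N)))) \<longlonglongrightarrow> 0" by simp
  moreover have "\<forall>\<^sub>F N in sequentially. norm (X N) \<le> sqrt (c * h (Suc (M N)))"
    using eventually_ge_at_top[of 1]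
  proof eventually_elim
    case (elim N)
    have "X N \<ge> 0" by (simp add: X_def)
    then show ?case using X2[OF elim] real_le_rsqrt by simp
  qed
  ultimately have "X \<longlonglongrightarrow> 0"
    by (rule Lim_null_comparison[rotated])
  then show ?thesis by (simp add: X_def[abs_def])
qed

text \<open>Scale j has \<open>2 ^ (m - j)\<close> blocks of length \<open>2 ^ j\<close>, so each of
  the m + 1 scales contributes at most \<open>K * 2 ^ m\<close> to the integral. The factor m + 1 of
  the dyadic bound gives (m + 1) squared, and normalization leaves m + 1 to the power
  \<open>- 1 - 2 * \<eta>\<close>, which is summable. Terms of an almost everywhere convergent
  series tend to 0.\<close>

lemma rademacher_menshov_AE:
  fixes U :: "nat \<Rightarrow> real ^ 'd::finite \<Rightarrow> complex"
  assumes U: "\<And>n. U n \<in> L2"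
    and K: "\<And>I. finite I \<Longrightarrow> (L2_norm (\<lambda>x. \<Sum>n\<in>I. U n x))\<^sup>2 \<le> K * real (card I)"
    and \<eta>: "\<eta> > 0"
  shows "AE x in torus. (\<lambda>N. sqrt (real N) / ln (1 + real N) powr (3 / 2 + \<eta>) *
    norm ((\<Sum>n<N. U n x) / of_nat N)) \<longlonglongrightarrow> 0"
proof -
  define B where "B j i x = (norm (\<Sum>n\<in>{i * 2 ^ j..<Suc i * 2 ^ j}. U n x))\<^sup>2" for j i :: nat and x
  define G where "G m x = real (m + 1) * (\<Sum>j\<le>m. \<Sum>i<2 ^ (m - j). B j i x)" for m x
  define h where "h m x = G m x / (2 ^ m * real (m + 1) powr (3 + 2 * \<eta>))" for m x
  have SG: "(norm (\<Sum>n<N. U n x))\<^sup>2 \<le> G m x" if "N \<le> 2 ^ m" for N m x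
  proof -
    have "(\<Sum>n\<in>{i * 2 ^ j..<Suc i * 2 ^ j}. U n x) =
        (\<Sum>n<Suc i * 2 ^ j. U n x) - (\<Sum>n<i * 2 ^ j. U n x)" for i j
      using sum_diff_nat_ivl[of 0 "i * 2 ^ j" "Suc i * 2 ^ j" "\<lambda>n. U n x"]
      by (simp add: atLeast0LessThan)
    then show ?thesis
      using norm_square_le_dyadic[of "\<lambda>N. \<Sum>n<N. U n x" N m] that by (simp add: G_def B_def)
  qed
  have Bint: "integrable torus (B j i)" for j i
    using L2_sum[of "{i * 2 ^ j..<Suc i * 2 ^ j}" U] U by (simp add: L2_def B_def[abs_def])
  have Bbound: "(LINT x|torus. B j i x) \<le> K * 2 ^ j" for j i
    using K[of "{i * 2 ^ j..<Suc i * 2 ^ j}"] by (simp add: L2_norm_square B_def)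
  have Gint: "integrable torus (G m)" for m
    unfolding G_def using Bint by simp
  have Gbound: "(LINT x|torus. G m x) \<le> K * (real (m + 1))\<^sup>2 * 2 ^ m" for m
  proof -
    have "(LINT x|torus. G m x) = real (m + 1) * (\<Sum>j\<le>m. \<Sum>i<2 ^ (m - j). LINT x|torus. B j i x)"
      unfolding G_def using Bint by simp
    also have "\<dots> \<le> real (m + 1) * (\<Sum>j\<le>m. \<Sum>i<(2::nat) ^ (m - j). K * 2 ^ j)"
      by (intro mult_left_mono sum_mono Bbound) auto
    also have "(\<Sum>j\<le>m. \<Sum>i<(2::nat) ^ (m - j). K * 2 ^ j) = (\<Sum>j\<le>m. K * 2 ^ m)"
      by (intro sum.cong refl) (simp add: mult_ac flip: power_add)
    finally show ?thesis by (simp add: power2_eq_square mult_ac)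
  qed
  have "AE x in torus. summable (\<lambda>m. h m x)"
  proof (rule AE_summable_of_summable_integrals)
    show "integrable torus (h m)" for m
      unfolding h_def using Gint by simp
    show "h m x \<ge> 0" for m x
      by (auto simp: h_def G_def B_def intro!: divide_nonneg_nonneg mult_nonneg_nonneg sum_nonneg)
    show "(LINT x|torus. h m x) \<le> K * real (Suc m) powr (- 1 - 2 * \<eta>)" for m
    proof -
      have "(LINT x|torus. h m x) = (LINT x|torus. G m x) / (2 ^ m * real (m + 1) powr (3 + 2 * \<eta>))"
        by (simp add: h_def)
      also have "\<dots> \<le> K * (real (m + 1))\<^sup>2 * 2 ^ m / (2 ^ m * real (m + 1) powr (3 + 2 * \<eta>))"
        by (intro divide_right_mono Gbound) auto
      also have "\<dots> = K * (real (m + 1) powr 2 / real (m + 1) powr (3 + 2 * \<eta>))"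
        by simp
      also have "real (m + 1) powr 2 / real (m + 1) powr (3 + 2 * \<eta>) = real (Suc m) powr (- 1 - 2 * \<eta>)"
      proof -
        have "2 - (3 + 2 * \<eta>) = - 1 - 2 * \<eta>" by simp
        then show ?thesis using powr_diff[of "real (m + 1)" 2 "3 + 2 * \<eta>"] by (metis Suc_eq_plus1)
      qed
      finally show ?thesis .
    qed
    have "summable (\<lambda>m. real m powr (- 1 - 2 * \<eta>))"
      using \<eta> by (simp add: summable_real_powr_iff)
    then have "summable (\<lambda>m. real (Suc m) powr (- 1 - 2 * \<eta>))"
      by (subst summable_Suc_iff)
    then show "summable (\<lambda>m. K * real (Suc m) powr (- 1 - 2 * \<eta>))"
      by (rule summable_mult)
  qed
  then show ?thesis
  proof eventually_elim
    case (elim x)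
    then have "(\<lambda>m. h m x) \<longlonglongrightarrow> 0" by (rule summable_LIMSEQ_zero)
    then show ?case
      by (intro tendsto_0_of_dyadic_bound[where G = "\<lambda>m. G m x"] SG \<eta>) (simp_all add: h_def)
  qed
qed

section \<open>Rate of convergence of the ergodic averages\<close>

text \<open>Taking logarithms in the growth bound controls |k| by an affine function of
  \<open>ln (1 + z)\<close>; as \<open>z \<ge> 1\<close> keeps this logarithm above
  \<open>ln 2\<close>, the constants can be absorbed.\<close>

lemma weight_le_log_weight:
  fixes c q \<delta> :: real
  assumes "c > 0" "q > 1" "\<delta> > 0"
  obtains D where "D \<ge> 0" "\<And>k z. z \<ge> 1 \<Longrightarrow> z \<ge> c * q powi \<bar>k\<bar> \<Longrightarrow>
    (1 + real_of_int \<bar>k\<bar>) powr (1 + \<delta>) \<le> D * ln (1 + z) powr (1 + \<delta>)"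
proof -
  \<comment> \<open>The first summand absorbs the 1 in 1 + |k|; the second bounds |k|, with
    \<open>\<bar>ln c\<bar> / ln 2\<close> absorbing the constant from \<open>c\<close>.\<close>
  define b where "b = 1 / ln 2 + (1 + \<bar>ln c\<bar> / ln 2) / ln q"
  have b0: "b \<ge> 0" using assms by (simp add: b_def)
  show thesis
  proof (rule that[of "b powr (1 + \<delta>)"])
    fix k :: int and z :: real
    assume z: "z \<ge> 1" and ge: "z \<ge> c * q powi \<bar>k\<bar>"
    let ?L = "ln (1 + z)"
    have L: "?L \<ge> ln 2" using z by simp
    have L1: "?L / ln 2 \<ge> 1" using L by simp
    have "q powi \<bar>k\<bar> = q powr real_of_int \<bar>k\<bar>"
      by (subst powr_real_of_int') (use assms in auto)
    then have "ln (c * q powi \<bar>k\<bar>) = ln c + real_of_int \<bar>k\<bar> * ln q"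
      using assms by (simp add: ln_mult ln_powr)
    moreover have "ln (c * q powi \<bar>k\<bar>) \<le> ?L"
      using ge z assms by (subst ln_le_cancel_iff) (auto intro!: mult_pos_pos zero_less_power_int)
    ultimately have "real_of_int \<bar>k\<bar> * ln q \<le> ?L + \<bar>ln c\<bar>" by linarith
    also have "\<dots> \<le> ?L + \<bar>ln c\<bar> * (?L / ln 2)"
      using mult_left_mono[OF L1, of "\<bar>ln c\<bar>"] by simp
    also have "\<dots> = (1 + \<bar>ln c\<bar> / ln 2) * ?L" by (simp add: algebra_simps)
    finally have "real_of_int \<bar>k\<bar> \<le> (1 + \<bar>ln c\<bar> / ln 2) * ?L / ln q"
      using assms by (subst pos_le_divide_eq) simp_all
    moreover have "b * ?L = ?L / ln 2 + (1 + \<bar>ln c\<bar> / ln 2) * ?L / ln q"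
      by (simp add: b_def distrib_right)
    ultimately have "1 + real_of_int \<bar>k\<bar> \<le> b * ?L" using L1 by linarith
    then have "(1 + real_of_int \<bar>k\<bar>) powr (1 + \<delta>) \<le> (b * ?L) powr (1 + \<delta>)"
      using assms by (intro powr_mono2) auto
    also have "\<dots> = b powr (1 + \<delta>) * ?L powr (1 + \<delta>)"
      by (rule powr_mult)
    finally show "(1 + real_of_int \<bar>k\<bar>) powr (1 + \<delta>) \<le> b powr (1 + \<delta>) * ?L powr (1 + \<delta>)" .
  qed simp
qed

lemma norm_real_vec_ge_1:
  assumes "\<zeta> \<noteq> 0"
  shows "norm (real_vec \<zeta>) \<ge> 1"
proof -
  from assms obtain i where "\<zeta> $ i \<noteq> 0" by (auto simp: vec_eq_iff)
  then have "1 \<le> norm (real_vec \<zeta> $ i)" by (simp add: real_vec_def)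
  also have "\<dots> \<le> norm (real_vec \<zeta>)" by (rule Finite_Cartesian_Product.norm_nth_le)
  finally show ?thesis .
qed

theorem corollary1p7:
  fixes A :: "int ^ 'd::finite ^ 'd"
    and E :: "(int ^ 'd) set"
    and Y :: "int set"
    and c q \<delta> :: real
    and f :: "real ^ 'd \<Rightarrow> complex"
  assumes "det A \<noteq> 0"
    and "E \<subseteq> UNIV - {0}"
    and "unilateral_shift (koopman A) (spectral_subspace E) \<and> Y = {0..} \<or>
         bilateral_shift (koopman A) (spectral_subspace E) \<and> Y = UNIV"
    and "c > 0" and "q > 1"
    and "\<And>\<xi> k. \<xi> \<in> E \<Longrightarrow> k \<in> Y \<Longrightarrow>
           norm (mat_powi_vec (transpose (real_mat A)) k (real_vec \<xi>)) \<ge> c * q powi \<bar>k\<bar>"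
    and "f \<in> L2"
    and "L2_has_sum (\<lambda>\<xi> x. fourier_coeff f \<xi> * character \<xi> x) f UNIV"
    and "\<delta> > 0"
    and "(\<lambda>\<xi>. ln (1 + norm (real_vec \<xi>)) powr (1 + \<delta>) * (norm (fourier_coeff f \<xi>))\<^sup>2)
           summable_on UNIV"
  shows "\<forall>\<eta>>0. AE x in torus.
           (\<lambda>N::nat. sqrt (real N) / ln (1 + real N) powr (3 / 2 + \<eta>) *
              norm ((\<Sum>n<N. f ((((*v) (real_mat A)) ^^ n) x)) / of_nat N - (LINT y|torus. f y)))
           \<longlonglongrightarrow> 0"
proof (intro allI impI)
  fix \<eta> :: real assume \<eta>: "\<eta> > 0"
  \<comment> \<open>The unilateral and the bilateral case merge here: in both the operator is an
    isometry and the index set is closed under adding 1.\<close>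
  have T: "isometry_op (koopman A)" and W: "generating_wandering Y (koopman A) (spectral_subspace E)"
    and Y: "\<And>k. k \<in> Y \<Longrightarrow> k + 1 \<in> Y"
    using assms(3) by (auto simp: unilateral_shift_def bilateral_shift_def unitary_op_def)
  have E0: "0 \<notin> E" using assms(2) by auto
  have "\<exists>k. \<zeta> \<noteq> 0 \<longrightarrow> k \<in> Y \<and> level A E k \<zeta>" for \<zeta>
    using level_exists[OF assms(1) T W] by blast
  then obtain \<kappa> where \<kappa>: "\<And>\<zeta>. \<zeta> \<noteq> 0 \<Longrightarrow> \<kappa> \<zeta> \<in> Y" "\<And>\<zeta>. \<zeta> \<noteq> 0 \<Longrightarrow> level A E (\<kappa> \<zeta>) \<zeta>"
    by metis
  have \<kappa>_dual: "\<kappa> (dual A \<zeta>) = \<kappa> \<zeta> + 1" if "\<zeta> \<noteq> 0" for \<zeta>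
  proof -
    have d: "dual A \<zeta> \<noteq> 0" using dual_pow_eq_0_iff[OF assms(1), of 1 \<zeta>] that by simp
    \<comment> \<open>Raising the level of \<zeta> by one gives a level of its dual image, and
      uniqueness makes it the chosen one.\<close>
    show ?thesis
      using level_unique[OF W E0 d \<kappa>(2)[OF d] \<kappa>(1)[OF d] level_dual[OF \<kappa>(2)[OF that]] Y[OF \<kappa>(1)[OF that]]] .
  qed
  define \<rho> where "\<rho> k = (1 + real_of_int \<bar>k\<bar>) powr (1 + \<delta>)" for k
  have \<rho>0: "\<rho> k > 0" for k by (simp add: \<rho>_def add_pos_nonneg)
  obtain R where R: "R > 0" "\<And>J. finite J \<Longrightarrow> (\<Sum>j\<in>J. 1 / \<rho> j) \<le> R"
    unfolding \<rho>_def using int_weight_sum_bounded[OF assms(9)] by metis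
  obtain D where D: "D \<ge> 0" "\<And>k z. z \<ge> 1 \<Longrightarrow> z \<ge> c * q powi \<bar>k\<bar> \<Longrightarrow> \<rho> k \<le> D * ln (1 + z) powr (1 + \<delta>)"
    unfolding \<rho>_def using weight_le_log_weight[OF assms(4,5,9)] by metis
  let ?w = "\<lambda>\<xi>. ln (1 + norm (real_vec \<xi>)) powr (1 + \<delta>) * (norm (fourier_coeff f \<xi>))\<^sup>2"
  define C where "C = D * infsum ?w UNIV"
  have C: "(\<Sum>\<zeta>\<in>F. \<rho> (\<kappa> \<zeta>) * (norm (fourier_coeff f \<zeta>))\<^sup>2) \<le> C" if F: "finite F" "0 \<notin> F" for F
  proof -
    have "(\<Sum>\<zeta>\<in>F. \<rho> (\<kappa> \<zeta>) * (norm (fourier_coeff f \<zeta>))\<^sup>2) \<le> (\<Sum>\<zeta>\<in>F. D * ?w \<zeta>)"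
    proof (rule sum_mono)
      fix \<zeta> assume "\<zeta> \<in> F"
      then have nz: "\<zeta> \<noteq> 0" using F(2) by auto
      \<comment> \<open>Exponential growth in the level is what lets the logarithmic weight of the
        hypothesis dominate the level weight.\<close>
      have "norm (real_vec \<zeta>) \<ge> c * q powi \<bar>\<kappa> \<zeta>\<bar>"
        using assms(1) \<kappa>(2)[OF nz] assms(6)[OF _ \<kappa>(1)[OF nz]] by (rule level_norm)
      then have "\<rho> (\<kappa> \<zeta>) \<le> D * ln (1 + norm (real_vec \<zeta>)) powr (1 + \<delta>)"
        by (rule D(2)[OF norm_real_vec_ge_1[OF nz]])
      then show "\<rho> (\<kappa> \<zeta>) * (norm (fourier_coeff f \<zeta>))\<^sup>2 \<le> D * ?w \<zeta>"
        by (simp add: mult_right_mono flip: mult.assoc)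
    qed
    also have "\<dots> = D * sum ?w F" by (simp add: sum_distrib_left)
    also have "\<dots> \<le> C"
      unfolding C_def using F(1) D(1) assms(10)
      by (intro mult_left_mono finite_sum_le_infsum) auto
    finally show ?thesis .
  qed
  define g where "g x = f x - (LINT y|torus. f y)" for x
  have g0: "g \<in> L2_zero_mean"
    using assms(7) by (simp add: g_def[abs_def] L2_zero_mean_centred)
  have "AE x in torus. (\<lambda>N. sqrt (real N) / ln (1 + real N) powr (3 / 2 + \<eta>) *
      norm ((\<Sum>n<N. (koopman A ^^ n) g x) / of_nat N)) \<longlonglongrightarrow> 0"
  proof (rule rademacher_menshov_AE[OF _ _ \<eta>])
    show "(koopman A ^^ n) g \<in> L2" for n
      using koopman_pow_zero_mean[OF T g0] by (simp add: L2_zero_mean_def)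
    show "(L2_norm (\<lambda>x. \<Sum>n\<in>I. (koopman A ^^ n) g x))\<^sup>2 \<le> 2 * R * C * real (card I)"
      if "finite I" for I
      unfolding g_def[abs_def]
      using assms(1) T \<kappa>_dual \<rho>0 R assms(7,8) C that by (rule L2_norm_ergodic_sum_le)
  qed
  \<comment> \<open>For N > 0 the mean may be subtracted inside or outside the average. At N = 0 the
    quotients are 0 by convention and the mean outside stays uncancelled, but the factor
    \<open>sqrt 0\<close> makes both sides vanish.\<close>
  moreover have "sqrt (real N) / ln (1 + real N) powr (3 / 2 + \<eta>) *
      norm ((\<Sum>n<N. (koopman A ^^ n) g x) / of_nat N) =
    sqrt (real N) / ln (1 + real N) powr (3 / 2 + \<eta>) *
      norm ((\<Sum>n<N. f (((*v) (real_mat A) ^^ n) x)) / of_nat N - (LINT y|torus. f y))" for N x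
    by (cases "N = 0") (simp_all add: koopman_pow g_def sum_subtractf diff_divide_distrib)
  ultimately show "AE x in torus. (\<lambda>N::nat. sqrt (real N) / ln (1 + real N) powr (3 / 2 + \<eta>) *
      norm ((\<Sum>n<N. f ((((*v) (real_mat A)) ^^ n) x)) / of_nat N - (LINT y|torus. f y))) \<longlonglongrightarrow> 0"
    by (simp only:)
qed

end
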